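(* Let $k$ be a positive integer and let $E_{p,q}$ denote the $k\times k$ matrix units. Let $$R^{*}_{k\times k,1}=\mathrm{span}\{(E_{p,q})_{[1,1]}(m,n)-(E_{q,p})_{[1,1]}(n,m)\mid 1\le p,q\le k,\ m,n\in\mathbb{N}\},$$ $$R^{*}_{k\times k,2}=\mathrm{span}\{(E_{p,q})_{[0,0]}(m,n)+(E_{q,p})_{[0,0]}(n,m)\mid 1\le p,q\le k,\ m,n\in\mathbb{N}\},$$ with the conformal algebra structures $(\partial,Y^+(\cdot,z))$ described in the context. Then: (1) The conformal algebras $R^{*}_{k\times k,1}$ and $R^{*}_{k\times k,2}$ are simple. (2) $R^{*}_{k\times k,1}$ is generated by its subspace of weight $2$, $(R^{*}_{k\times k,1})^{(2)}=\mathrm{span}\{(E_{p,q})_{[1,1]}(1,0)-(E_{q,p})_{[1,1]}(0,1)\mid 1\le p,q\le k\}$, when $k>1$, and by the set $\{(I_1)_{[1,1]}(1,0)-(I_1)_{[1,1]}(0,1),\ (I_1)_{[1,1]}(3,0)-(I_1)_{[1,1]}(0,3)\}$ if $k=1$. (3) $R^{*}_{k\times k,2}$ is generated by its subspace of weight $2$, $(R^{*}_{k\times k,2})^{(2)}=\mathrm{span}\{(E_{p,q})_{[0,0]}(0,0)+(E_{q,p})_{[0,0]}(0,0)\mid 1\le p,q\le k\}$, when $k>1$, and by the set $\{(I_1)_{[0,0]}(0,0),\ (I_1)_{[0,0]}(1,1)\}$ if $k=1$.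
   Context: Conventions. $\mathbb{F}$ is an arbitrary field of characteristic $0$; $\mathbb{N}=\{0,1,2,\dots\}$; $\binom{a}{n}=a(a-1)\cdots(a-n+1)/n!$ for $a\in\mathbb{Z}$, $n\in\mathbb{N}$. $I_1$ is the $1\times 1$ identity matrix. $\mathrm{Res}_x$ takes the coefficient of $x^{-1}$. All binomials such as $(z-x)^{-1}$ are expanded in nonnegative powers of the second variable. $LM(V_1,V_2)$ is the space of linear maps $V_1\to V_2$. Conformal superalgebra. A conformal superalgebra $(R,\partial,Y^+(\cdot,z))$ is a $\mathbb{Z}_2$-graded $\mathbb{F}[\partial]$-module $R=R_0\oplus R_1$ with a $\mathbb{Z}_2$-graded linear map $Y^+(\cdot,z):R\to LM(R,R[z^{-1}]z^{-1})$ such that, for $u\in R_i$, $v\in R_j$: $Y^+(\partial u,z)=\frac{d}{dz}Y^+(u,z)$; $Y^+(u,z)v=(-1)^{ij}\mathrm{Res}_x\frac{e^{x\partial}Y^+(v,-x)u}{z-x}$; $Y^+(u,z_1)Y^+(v,z_2)-(-1)^{ij}Y^+(v,z_2)Y^+(u,z_1)=\mathrm{Res}_x\frac{Y^+(Y^+(u,z_1-x)v,x)}{z_2-x}$. If $R_1=\{0\}$ it is called a conformal algebra. Write $Y^+(u,z)=\sum_{n\ge 0}u_nz^{-n-1}$. An ideal is a subspace $\mathcal{I}\subset R$ with $\partial(\mathcal{I})\subset\mathcal{I}$ and $Y^+(u,z)\mathcal{I}\subset\mathcal{I}[z^{-1}]$ for all $u\in R$. $R$ is simple if its only ideals are $\{0\}$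 and $R$. A (sub-)algebra $R'$ is generated by a subset $S$ if $R'=\mathrm{span}\{u^1_{m_1}\cdots u^p_{m_p}v\mid u^1,\dots,u^p,v\in S,\ p,m_1,\dots,m_p\in\mathbb{N}\}$ (for $p=0$ the expression is $v$). Construction. Let $\mathcal{A}=M_{k\times k}(\mathbb{F})$ be the algebra of $k\times k$ matrices. For each $i\in\{0,1\}$ take the vector space $\mathcal{A}\otimes\mathbb{F}[t_1,t_2]$ and denote $u\otimes t_1^mt_2^n$ in the $i$-th copy by $u_{[i,i]}(m,n)$ ($u\in\mathcal{A}$, $m,n\in\mathbb{N}$). On each copy define $$\partial u_{[i,i]}(m,n)=(m+1)u_{[i,i]}(m+1,n)+(n+1)u_{[i,i]}(m,n+1)$$ and $$Y^+(u_{[i,i]}(m_1,m_2),z)v_{[i,i]}(n_1,n_2)=(n_1\delta_{i,0}+1)\binom{-n_1-1-\delta_{i,0}}{m_2}\sum_{p=0}^{m_1+m_2+n_1+\delta_{i,0}}\binom{p}{m_1}(uv)_{[i,i]}(p,n_2)z^{p-m_1-m_2-n_1-1-\delta_{i,0}}$$ $$-\bigl(\delta_{i,1}-(n_2+1)\delta_{i,0}\bigr)\binom{-n_2-1-\delta_{i,0}}{m_1}\sum_{q=0}^{m_1+m_2+n_2+\delta_{i,0}}\binom{q}{m_2}(vu)_{[i,i]}(n_1,q)z^{q-m_1-m_2-n_2-1-\delta_{i,0}}.$$ Each copy is a conformal algebra (odd part zero), and the subspaces $R^{*}_{k\times k,1}$, $R^{*}_{k\times k,2}$ of the claim are closed under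 $\partial$ and $Y^+$, hence are conformal algebras with the restricted structure. The weight of $u_{[0,0]}(m,n)$ is $m+n+2$ and the weight of $u_{[1,1]}(m,n)$ is $m+n+1$; a superscript $(w)$ denotes the subspace of elements of weight $w$. *)

theory Defs
  imports "HOL-Analysis.Analysis" "HOL-Library.Poly_Mapping"
begin

section \<open>Conformal superalgebras\<close>

text \<open>
  An element of \<open>R[z\<^sup>-\<^sup>1]z\<^sup>-\<^sup>1\<close> is encoded as a finitely supported map \<^typ>\<open>nat \<Rightarrow>\<^sub>0 'v\<close>
  whose value at \<open>n\<close> is the coefficient of \<open>z\<^sup>-\<^sup>n\<^sup>-\<^sup>1\<close>. Thus \<open>Y u v\<close> stands for \<open>Y\<^sup>+(u,z)v\<close>, and
  its value at \<open>n\<close> is \<open>u\<^sub>n v\<close>.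
\<close>

abbreviation mode :: "('v \<Rightarrow> 'v \<Rightarrow> (nat \<Rightarrow>\<^sub>0 'v::zero)) \<Rightarrow> 'v \<Rightarrow> nat \<Rightarrow> 'v \<Rightarrow> 'v" where
  "mode Y u n v \<equiv> Poly_Mapping.lookup (Y u v) n"

definition total_space :: "(nat \<Rightarrow> 'v set) \<Rightarrow> 'v::ab_group_add set" where
  "total_space G = {u + v |u v. u \<in> G 0 \<and> v \<in> G 1}"

text \<open>
  The algebra is a subspace of an ambient vector space: \<open>G 0\<close> and \<open>G 1\<close> are its even and odd parts,
  and \<open>D\<close> and \<open>Y\<close> are only constrained on \<open>G 0 \<oplus> G 1\<close>. The last three axioms are the coefficients of
  the three defining identities of \<open>Y\<^sup>+\<close>:

  \<^item> of \<open>z\<^sup>-\<^sup>n\<^sup>-\<^sup>1\<close> in \<open>Y\<^sup>+(\<partial>u,z) = d/dz Y\<^sup>+(u,z)\<close> (for \<open>n = 0\<close> the right-hand side is 0);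

  \<^item> of \<open>z\<^sup>-\<^sup>n\<^sup>-\<^sup>1\<close> in skew-symmetry, where \<open>1/(z-x)\<close> is the sum of the \<open>x\<^sup>nz\<^sup>-\<^sup>n\<^sup>-\<^sup>1\<close>, so that the residue
    pairs \<open>v\<^sub>p u (-x)\<^sup>-\<^sup>p\<^sup>-\<^sup>1\<close> with the term of \<open>e\<^sup>x\<^sup>\<partial>\<close> of degree \<open>p - n\<close> (terms with \<open>v\<^sub>p u = 0\<close> are
    left out to make the sum finite);

  \<^item> of \<open>z\<^sub>1\<^sup>-\<^sup>m\<^sup>-\<^sup>1z\<^sub>2\<^sup>-\<^sup>n\<^sup>-\<^sup>1\<close> in the Jacobi identity, where \<open>(z\<^sub>1-x)\<^sup>-\<^sup>p\<^sup>-\<^sup>1\<close> contributes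
    \<open>(m choose p) x\<^sup>m\<^sup>-\<^sup>p\<close> at \<open>z\<^sub>1\<^sup>-\<^sup>m\<^sup>-\<^sup>1\<close>.
\<close>

locale conformal_superalgebra = vector_space smul
  for smul :: "'f::field_char_0 \<Rightarrow> 'v::ab_group_add \<Rightarrow> 'v" (infixr "\<cdot>" 75) +
  fixes G :: "nat \<Rightarrow> 'v set"
    and D :: "'v \<Rightarrow> 'v"
    and Y :: "'v \<Rightarrow> 'v \<Rightarrow> (nat \<Rightarrow>\<^sub>0 'v)"
  assumes part_subspace: "i < 2 \<Longrightarrow> subspace (G i)"
    and parts_disjoint: "G 0 \<inter> G 1 = {0}"
    and D_add: "\<lbrakk>u \<in> total_space G; v \<in> total_space G\<rbrakk> \<Longrightarrow> D (u + v) = D u + D v"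
    and D_scale: "u \<in> total_space G \<Longrightarrow> D (c \<cdot> u) = c \<cdot> D u"
    and D_graded: "\<lbrakk>i < 2; u \<in> G i\<rbrakk> \<Longrightarrow> D u \<in> G i"
    and Y_add_left: "\<lbrakk>u \<in> total_space G; u' \<in> total_space G; v \<in> total_space G\<rbrakk>
          \<Longrightarrow> mode Y (u + u') n v = mode Y u n v + mode Y u' n v"
    and Y_scale_left: "\<lbrakk>u \<in> total_space G; v \<in> total_space G\<rbrakk>
          \<Longrightarrow> mode Y (c \<cdot> u) n v = c \<cdot> mode Y u n v"
    and Y_add_right: "\<lbrakk>u \<in> total_space G; v \<in> total_space G; v' \<in> total_space G\<rbrakk>
          \<Longrightarrow> mode Y u n (v + v') = mode Y u n v + mode Y u n v'"
    and Y_scale_right: "\<lbrakk>u \<in> total_space G; v \<in> total_space G\<rbrakk>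
          \<Longrightarrow> mode Y u n (c \<cdot> v) = c \<cdot> mode Y u n v"
    and Y_graded: "\<lbrakk>i < 2; j < 2; u \<in> G i; v \<in> G j\<rbrakk> \<Longrightarrow> mode Y u n v \<in> G ((i + j) mod 2)"
    and derivation: "\<lbrakk>u \<in> total_space G; v \<in> total_space G\<rbrakk>
          \<Longrightarrow> mode Y (D u) n v = (- of_nat n) \<cdot> mode Y u (n - 1) v"
    and skew_symmetry: "\<lbrakk>i < 2; j < 2; u \<in> G i; v \<in> G j\<rbrakk>
          \<Longrightarrow> mode Y u n v = (- 1) ^ (i * j) \<cdot>
                (\<Sum>p | p \<in> Poly_Mapping.keys (Y v u) \<and> n \<le> p.
                   ((- 1) ^ (p + 1) / fact (p - n)) \<cdot> (D ^^ (p - n)) (mode Y v p u))"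
    and jacobi: "\<lbrakk>i < 2; j < 2; u \<in> G i; v \<in> G j; w \<in> total_space G\<rbrakk>
          \<Longrightarrow> mode Y u m (mode Y v n w) - (- 1) ^ (i * j) \<cdot> mode Y v n (mode Y u m w)
            = (\<Sum>p\<le>m. of_nat (m choose p) \<cdot> mode Y (mode Y u p v) (m + n - p) w)"

definition conformal_algebra ::
    "('f::field_char_0 \<Rightarrow> 'v \<Rightarrow> 'v) \<Rightarrow> 'v::ab_group_add set \<Rightarrow> ('v \<Rightarrow> 'v) \<Rightarrow>
     ('v \<Rightarrow> 'v \<Rightarrow> (nat \<Rightarrow>\<^sub>0 'v)) \<Rightarrow> bool" where
  "conformal_algebra smul R D Y \<longleftrightarrow>
     conformal_superalgebra smul (\<lambda>i. if i = 0 then R else {0}) D Y"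

definition conformal_ideal ::
    "('f::field_char_0 \<Rightarrow> 'v \<Rightarrow> 'v) \<Rightarrow> 'v::ab_group_add set \<Rightarrow> ('v \<Rightarrow> 'v) \<Rightarrow>
     ('v \<Rightarrow> 'v \<Rightarrow> (nat \<Rightarrow>\<^sub>0 'v)) \<Rightarrow> 'v set \<Rightarrow> bool" where
  "conformal_ideal smul R D Y I \<longleftrightarrow>
     I \<subseteq> R \<and> module.subspace smul I \<and> D ` I \<subseteq> I \<and> (\<forall>u\<in>R. \<forall>v\<in>I. \<forall>n. mode Y u n v \<in> I)"

definition conformal_simple ::
    "('f::field_char_0 \<Rightarrow> 'v \<Rightarrow> 'v) \<Rightarrow> 'v::ab_group_add set \<Rightarrow> ('v \<Rightarrow> 'v) \<Rightarrow>
     ('v \<Rightarrow> 'v \<Rightarrow> (nat \<Rightarrow>\<^sub>0 'v)) \<Rightarrow> bool" where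
  "conformal_simple smul R D Y \<longleftrightarrow> {I. conformal_ideal smul R D Y I} = {{0}, R}"

text \<open>The list \<open>[(u\<^sup>1, m\<^sub>1), \<dots>, (u\<^sup>p, m\<^sub>p)]\<close> and \<open>v\<close> yield \<open>u\<^sup>1\<^sub>m\<^sub>1 \<dots> u\<^sup>p\<^sub>m\<^sub>p v\<close>.\<close>

definition generated_by ::
    "('f::field_char_0 \<Rightarrow> 'v \<Rightarrow> 'v) \<Rightarrow> 'v::ab_group_add set \<Rightarrow>
     ('v \<Rightarrow> 'v \<Rightarrow> (nat \<Rightarrow>\<^sub>0 'v)) \<Rightarrow> 'v set \<Rightarrow> bool" where
  "generated_by smul R Y S \<longleftrightarrow>
     R = module.span smul
           {foldr (\<lambda>(u, m) w. mode Y u m w) us v |us v. fst ` set us \<subseteq> S \<and> v \<in> S}"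


section \<open>The algebras built from \<open>k \<times> k\<close> matrices\<close>

text \<open>
  The index type \<open>'n\<close> has \<open>k\<close> elements. An element of \<open>M\<^bsub>k\<times>k\<^esub>(F) \<otimes> F[t\<^sub>1,t\<^sub>2]\<close> is the finitely supported
  family of its matrix coefficients. Both copies (\<open>i = 0\<close> and \<open>i = 1\<close>) have this type; they are told
  apart by the argument \<open>i\<close> of \<open>Yplus\<close> and \<open>weight_space\<close>, while \<open>\<partial>\<close> is given by the same formula on
  both. \<open>elt u m n\<close> is \<open>u \<otimes> t\<^sub>1\<^sup>mt\<^sub>2\<^sup>n\<close>, that is \<open>u\<^bsub>[i,i]\<^esub>(m,n)\<close>.
\<close>

type_synonym ('f, 'n) matpoly = "nat \<times> nat \<Rightarrow>\<^sub>0 'f^'n^'n"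

definition mscale :: "'f::field_char_0 \<Rightarrow> ('f, 'n::finite) matpoly \<Rightarrow> ('f, 'n) matpoly" where
  "mscale c = Poly_Mapping.map (map_matrix ((*) c))"

definition elt :: "'f::field_char_0^'n^'n \<Rightarrow> nat \<Rightarrow> nat \<Rightarrow> ('f, 'n::finite) matpoly" where
  "elt u m n = Poly_Mapping.single (m, n) u"

definition matunit :: "'n \<Rightarrow> 'n \<Rightarrow> 'f::field_char_0^'n^'n::finite" where
  "matunit p q = (\<chi> i j. if i = p \<and> j = q then 1 else 0)"

definition partial :: "('f::field_char_0, 'n::finite) matpoly \<Rightarrow> ('f, 'n) matpoly" where
  "partial f = (\<Sum>(m, n)\<in>Poly_Mapping.keys f. let u = Poly_Mapping.lookup f (m, n) in
     mscale (of_nat (m + 1)) (elt u (m + 1) n) + mscale (of_nat (n + 1)) (elt u m (n + 1)))"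

text \<open>
  With \<open>d = \<delta>\<^bsub>i,0\<^esub>\<close> and \<open>N = m\<^sub>1 + m\<^sub>2 + n\<^sub>1 + d\<close>, the power \<open>z\<^bsup>p-N-1\<^esup>\<close> sits at index \<open>N - p\<close>
  (no truncation occurs since \<open>p \<le> N\<close>), and likewise in the second sum.
\<close>

definition Yplus_elt ::
    "nat \<Rightarrow> 'f::field_char_0^'n^'n \<Rightarrow> nat \<Rightarrow> nat \<Rightarrow> 'f^'n^'n \<Rightarrow> nat \<Rightarrow> nat
     \<Rightarrow> (nat \<Rightarrow>\<^sub>0 ('f, 'n::finite) matpoly)" where
  "Yplus_elt i u m1 m2 v n1 n2 =
     (let d = of_bool (i = 0); N = m1 + m2 + n1 + d; N' = m1 + m2 + n2 + d in
       (\<Sum>p\<le>N. Poly_Mapping.single (N - p)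
          (mscale ((of_nat n1 * of_bool (i = 0) + 1)
                   * ((- of_nat n1 - 1 - of_bool (i = 0)) gchoose m2) * of_nat (p choose m1))
             (elt (u ** v) p n2)))
     - (\<Sum>q\<le>N'. Poly_Mapping.single (N' - q)
          (mscale ((of_bool (i = 1) - (of_nat n2 + 1) * of_bool (i = 0))
                   * ((- of_nat n2 - 1 - of_bool (i = 0)) gchoose m1) * of_nat (q choose m2))
             (elt (v ** u) n1 q))))"

definition Yplus ::
    "nat \<Rightarrow> ('f::field_char_0, 'n::finite) matpoly \<Rightarrow> ('f, 'n) matpoly
     \<Rightarrow> (nat \<Rightarrow>\<^sub>0 ('f, 'n) matpoly)" where
  "Yplus i f g = (\<Sum>(m1, m2)\<in>Poly_Mapping.keys f. \<Sum>(n1, n2)\<in>Poly_Mapping.keys g.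
     Yplus_elt i (Poly_Mapping.lookup f (m1, m2)) m1 m2 (Poly_Mapping.lookup g (n1, n2)) n1 n2)"

definition weight_space :: "nat \<Rightarrow> nat \<Rightarrow> ('f::field_char_0, 'n::finite) matpoly set" where
  "weight_space i w =
     {f. \<forall>(m, n)\<in>Poly_Mapping.keys f. m + n + (if i = 0 then 2 else 1) = w}"

lemma lookup_mscale:
  "Poly_Mapping.lookup (mscale c f) x = map_matrix ((*) c) (Poly_Mapping.lookup f x)"
  by (simp add: mscale_def map.rep_eq when_def map_matrix_def vec_eq_iff)

lemma vector_space_mscale: "vector_space mscale"
  by unfold_locales
    (auto intro!: poly_mapping_eqI
      simp: lookup_mscale lookup_add map_matrix_def vec_eq_iff algebra_simps)

lemma partial_elt:
  "partial (elt u m n) =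
     mscale (of_nat (m + 1)) (elt u (m + 1) n) + mscale (of_nat (n + 1)) (elt u m (n + 1))"
proof -
  interpret vector_space "mscale :: 'a \<Rightarrow> ('a, 'b) matpoly \<Rightarrow> _" by (rule vector_space_mscale)
  show ?thesis by (cases "u = 0") (simp_all add: partial_def elt_def)
qed

lemma Yplus_elt:
  "Yplus i (elt u m1 m2) (elt v n1 n2) = Yplus_elt i u m1 m2 v n1 n2"
proof -
  interpret vector_space "mscale :: 'a \<Rightarrow> ('a, 'b) matpoly \<Rightarrow> _" by (rule vector_space_mscale)
  have zero: "0 ** a = 0" "a ** 0 = 0" for a :: "'a^'b^'b"
    by (simp_all add: matrix_matrix_mult_def vec_eq_iff)
  show ?thesis
    by (cases "u = 0"; cases "v = 0")
      (simp_all add: Yplus_def Yplus_elt_def elt_def Let_def zero)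
qed

end

theory Submission
  imports Defs
begin

text \<open>
  Read \<open>u(m,n)\<close> as the matrix polynomial \<open>u x\<^sup>m y\<^sup>n / (m! n!)\<close>. Then \<open>\<partial>\<close> is multiplication by \<open>x + y\<close>, and
  the generating function of the modes is the \<open>\<lambda>\<close>-bracket
  \<open>h(\<lambda>+x) f(x,-\<lambda>-x) g(\<lambda>+x,y) + s h(\<lambda>+y) g(x,\<lambda>+y) f(-\<lambda>-y,y)\<close>, with \<open>s = -1\<close> and \<open>h = 1\<close> for
  \<open>i = 1\<close>, and \<open>s = 1\<close> and \<open>h(t) = t\<close> for \<open>i = 0\<close>. As the field is infinite, the
  axioms may be checked at points, where they are identities between products of matrices.

  The map \<open>f(x,y) \<mapsto> s f(y,x)\<^sup>T\<close> is an automorphism, \<open>R\<^sup>*\<close> is its fixed set, and modes commute with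
  symmetrization. For simplicity, let \<open>w(y)\<close> be the coefficient of the highest power of \<open>x\<close> in a nonzero
  element of an ideal. The top modes of the symmetrizations of \<open>u(i,j)\<close> with \<open>j\<close> large turn that element into
  the symmetrization of \<open>u x\<^sup>i w(y)\<close>, and those with \<open>i\<close> large then replace \<open>w(y)\<close> by any \<open>w\<^sub>t\<^sub>o\<^sub>p u' y\<^sup>j\<close>; matrix
  units on both sides of \<open>w\<^sub>t\<^sub>o\<^sub>p\<close> give all generators of \<open>R\<^sup>*\<close>.

  For generation, the span of the words is closed under all modes of its own elements by the Jacobi
  identity, and under \<open>\<partial>\<close>, which is a multiple of the mode of index 0 of the symmetrization of \<open>1(i,0)\<close>.
  Modulo \<open>\<partial>\<close> the symmetrization of \<open>u(m,n)\<close> is a multiple of that of \<open>u(m+n,0)\<close>, and those of positive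
  degree are reached by induction with modes of index 0 and 1 of the given generators.
\<close>

section \<open>Modes of monomials\<close>

definition mat_scale :: "'f::field_char_0 \<Rightarrow> 'f^'n^'n \<Rightarrow> 'f^'n^'n::finite" where
  "mat_scale c = map_matrix ((*) c)"

interpretation ms: vector_space "mscale :: 'f::field_char_0 \<Rightarrow> ('f, 'n::finite) matpoly \<Rightarrow> _"
  by (rule vector_space_mscale)

interpretation sm: vector_space "mat_scale :: 'f::field_char_0 \<Rightarrow> 'f^'n^'n::finite \<Rightarrow> _"
  by unfold_locales (auto simp: mat_scale_def vec_eq_iff algebra_simps)

lemma mat_scale_mult_left: "mat_scale c A ** B = mat_scale c (A ** B)"
  by (simp add: mat_scale_def vec_eq_iff matrix_matrix_mult_def sum_distrib_left mult_ac)

lemma mat_scale_mult_right: "A ** mat_scale c B = mat_scale c (A ** B)"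
  by (simp add: mat_scale_def vec_eq_iff matrix_matrix_mult_def sum_distrib_left mult_ac)

lemma matrix_add_rdistrib: "(A + B) ** C = A ** C + B ** (C :: 'a::semiring_1^'n^'n)"
  by (simp add: vec_eq_iff matrix_matrix_mult_def sum.distrib algebra_simps)

lemma matrix_zero_left: "0 ** A = (0 :: 'a::semiring_1^'n^'n)"
  by (simp add: vec_eq_iff matrix_matrix_mult_def)

lemma matrix_zero_right: "A ** 0 = (0 :: 'a::semiring_1^'n^'n)"
  by (simp add: vec_eq_iff matrix_matrix_mult_def)

lemma matrix_sum_left: "sum F S ** A = (\<Sum>x\<in>S. F x ** (A :: 'a::semiring_1^'n^'n))"
  by (induction S rule: infinite_finite_induct) (auto simp: matrix_add_rdistrib matrix_zero_left)

lemma matrix_sum_right: "A ** sum F S = (\<Sum>x\<in>S. (A :: 'a::semiring_1^'n^'n) ** F x)"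
  by (induction S rule: infinite_finite_induct) (auto simp: matrix_add_ldistrib matrix_zero_right)

lemma transpose_add: "transpose (A + B) = transpose A + transpose B"
  by (simp add: vec_eq_iff transpose_def)

lemma transpose_mat_scale: "transpose (mat_scale c A) = mat_scale c (transpose A)"
  by (simp add: mat_scale_def vec_eq_iff transpose_def)

lemma transpose_mult: "transpose (A ** B) = transpose B ** transpose (A :: 'a::comm_semiring_1^'n^'n)"
  by (rule matrix_transpose_mul)

lemma elt_0 [simp]: "elt 0 m n = 0"
  by (simp add: elt_def)

lemma elt_add: "elt (u + v) m n = elt u m n + elt v m n"
  by (simp add: elt_def single_add)

lemma elt_uminus: "elt (- u) m n = - elt u m n"
  by (simp add: elt_def single_uminus)

lemma elt_sum: "elt (sum F S) m n = (\<Sum>x\<in>S. elt (F x) m n)"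
  by (induction S rule: infinite_finite_induct) (auto simp: elt_add)

lemma elt_mat_scale: "elt (mat_scale c u) m n = mscale c (elt u m n)"
  by (rule poly_mapping_eqI)
    (simp add: lookup_mscale elt_def lookup_single when_def mat_scale_def map_matrix_def vec_eq_iff)

lemma matpoly_expand:
  "f = (\<Sum>x\<in>Poly_Mapping.keys f. elt (Poly_Mapping.lookup f x) (fst x) (snd x))"
proof (rule poly_mapping_eqI)
  fix k
  show "Poly_Mapping.lookup f k = Poly_Mapping.lookup
      (\<Sum>x\<in>Poly_Mapping.keys f. elt (Poly_Mapping.lookup f x) (fst x) (snd x)) k"
    by (auto simp: lookup_sum elt_def lookup_single when_def in_keys_iff if_distrib cong: if_cong)
qed

text \<open>Properties linear in \<open>f\<close> reduce to monomials. Since \<open>u\<close> ranges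
  over all matrices, monomials and sums already cover scalar multiples.\<close>

lemma matpoly_induct [case_names elt add]:
  assumes "\<And>u m n. P (elt u m n)" and "\<And>f g. P f \<Longrightarrow> P g \<Longrightarrow> P (f + g)"
  shows "P f"
proof -
  have "finite S \<Longrightarrow> P (\<Sum>x\<in>S. elt (Poly_Mapping.lookup f x) (fst x) (snd x))" for S
  proof (induction S rule: finite_induct)
    case empty
    then show ?case using assms(1)[of 0 0 0] by simp
  next
    case (insert x S)
    then show ?case using assms by simp
  qed
  then show ?thesis by (subst matpoly_expand) simp
qed

lemma partial_add: "partial (f + g) = partial f + partial g"
proof -
  \<comment> \<open>The summand becomes a function of key and coefficient, additive in the
    coefficient, so cancellation in the support of \<open>f + g\<close> does no harm. The same
    rewriting serves \<open>Yplus\<close> and all later sums over keys.\<close>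
  have *: "partial f = (\<Sum>k\<in>Poly_Mapping.keys f. (\<lambda>k u. case k of (m, n) \<Rightarrow>
      mscale (of_nat (m + 1)) (elt u (m + 1) n) + mscale (of_nat (n + 1)) (elt u m (n + 1)))
      k (Poly_Mapping.lookup f k))"
    for f :: "('a, 'b) matpoly"
    by (simp add: partial_def Let_def case_prod_unfold)
  show ?thesis
    unfolding * by (rule setsum_keys_plus_distrib)
      (auto simp: elt_add ms.scale_right_distrib split: prod.splits)
qed

lemma partial_mscale: "partial (mscale c f) = mscale c (partial f)"
proof (induction f rule: matpoly_induct)
  case (elt u m n)
  have "mscale c (elt u m n) = elt (mat_scale c u) m n" by (simp add: elt_mat_scale)
  then show ?case by (simp only: partial_elt) (simp add: elt_mat_scale ms.scale_right_distrib
    mult.commute)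
qed (simp add: partial_add ms.scale_right_distrib)

section \<open>Bilinearity of the modes and their values on monomials\<close>

lemma Yplus_elt_add_left:
  "Yplus_elt i (u + u') m1 m2 v n1 n2 = Yplus_elt i u m1 m2 v n1 n2 + Yplus_elt i u' m1 m2 v n1 n2"
  by (simp add: Yplus_elt_def Let_def matrix_add_rdistrib matrix_add_ldistrib elt_add
      ms.scale_right_distrib single_add sum.distrib)

lemma Yplus_elt_add_right:
  "Yplus_elt i u m1 m2 (v + v') n1 n2 = Yplus_elt i u m1 m2 v n1 n2 + Yplus_elt i u m1 m2 v' n1 n2"
  by (simp add: Yplus_elt_def Let_def matrix_add_rdistrib matrix_add_ldistrib elt_add
      ms.scale_right_distrib single_add sum.distrib)

lemma Yplus_elt_0: "Yplus_elt i 0 m1 m2 v n1 n2 = 0" "Yplus_elt i u m1 m2 0 n1 n2 = 0"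
  by (simp_all add: Yplus_elt_def Let_def matrix_zero_left matrix_zero_right)

lemma Yplus_add_left: "Yplus i (f + f') g = Yplus i f g + Yplus i f' g"
proof -
  have *: "Yplus i f g = (\<Sum>k\<in>Poly_Mapping.keys f. (\<lambda>k u. \<Sum>l\<in>Poly_Mapping.keys g.
      Yplus_elt i u (fst k) (snd k) (Poly_Mapping.lookup g l) (fst l) (snd l))
      k (Poly_Mapping.lookup f k))"
    for f :: "('a, 'b) matpoly"
    by (simp add: Yplus_def case_prod_unfold)
  show ?thesis
    unfolding * by (rule setsum_keys_plus_distrib)
      (auto simp: Yplus_elt_add_left Yplus_elt_0 sum.distrib)
qed

lemma Yplus_add_right: "Yplus i f (g + g') = Yplus i f g + Yplus i f g'"
proof -
  have *: "Yplus i f g = (\<Sum>l\<in>Poly_Mapping.keys g. (\<lambda>l v. \<Sum>k\<in>Poly_Mapping.keys f.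
      Yplus_elt i (Poly_Mapping.lookup f k) (fst k) (snd k) v (fst l) (snd l))
      l (Poly_Mapping.lookup g l))"
    for g :: "('a, 'b) matpoly"
    unfolding Yplus_def case_prod_unfold prod.collapse by (rule sum.swap)
  show ?thesis
    unfolding * by (rule setsum_keys_plus_distrib)
      (auto simp: Yplus_elt_add_right Yplus_elt_0 sum.distrib)
qed

text \<open>The Kronecker delta of \<open>i\<close> and 0: the extra pole order in the copy
  \<open>i = 0\<close>.\<close>

definition pole_shift :: "nat \<Rightarrow> nat" where "pole_shift i = of_bool (i = 0)"

definition flip_sign :: "nat \<Rightarrow> 'f::field_char_0" where "flip_sign i = (if i = 0 then 1 else - 1)"

text \<open>
  The coefficient of the first sum in \<open>Y\<^sup>+\<close> at index \<open>n\<close>; the test guards the truncated subtraction. Up to the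
  sign \<open>flip_sign i\<close>, the second sum is the first one with the roles of \<open>t\<^sub>1\<close> and \<open>t\<^sub>2\<close> exchanged.
\<close>

definition mode_coeff :: "nat \<Rightarrow> nat \<Rightarrow> nat \<Rightarrow> nat \<Rightarrow> nat \<Rightarrow> 'f::field_char_0" where
  "mode_coeff i m1 m2 n1 n = (if n \<le> m1 + m2 + n1 + pole_shift i
     then of_nat (n1 * pole_shift i + 1) * ((- 1) ^ m2 * of_nat ((n1 + pole_shift i + m2) choose m2))
       * of_nat ((m1 + m2 + n1 + pole_shift i - n) choose m1) else 0)"

text \<open>Upper negation: the generalized binomials of the construction become signed natural
  ones, which combine with factorials.\<close>

lemma gbinomial_neg:
  "(- of_nat n - 1 - of_bool b) gchoose m
    = ((- 1) ^ m * of_nat ((n + of_bool b + m) choose m) :: 'f::field_char_0)"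
proof -
  have "- of_nat n - 1 - of_bool b = (- of_nat (n + of_bool b + 1) :: 'f)"
    by simp
  also have "(\<dots> gchoose m) = (- 1) ^ m * (of_nat (n + of_bool b + m) gchoose m)"
    by (subst gbinomial_minus) (simp add: algebra_simps)
  finally show ?thesis by (simp add: binomial_gbinomial)
qed

lemma lookup_sum_single_diff:
  "Poly_Mapping.lookup (\<Sum>p\<le>N. Poly_Mapping.single (N - p) (X p)) n
    = (if n \<le> (N::nat) then X (N - n) else 0)"
proof -
  have "Poly_Mapping.lookup (\<Sum>p\<le>N. Poly_Mapping.single (N - p) (X p)) n
      = (\<Sum>p\<le>N. if p = N - n then (if n \<le> N then X (N - n) else 0) else 0)"
    unfolding lookup_sum by (rule sum.cong) (auto simp: lookup_single when_def)
  then show ?thesis by simp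
qed

text \<open>Index \<open>n\<close> selects the summand \<open>p = N - n\<close> of each sum. Where
  this subtraction is truncated, \<open>mode_coeff\<close> is 0, so the wrong exponent is
  harmless.\<close>

lemma mode_elt:
  assumes "i < 2"
  shows "mode (Yplus i) (elt u m1 m2) n (elt v n1 n2)
    = mscale (mode_coeff i m1 m2 n1 n) (elt (u ** v) (m1 + m2 + n1 + pole_shift i - n) n2)
    + mscale (flip_sign i * mode_coeff i m2 m1 n2 n) (elt (v ** u) n1 (m1 + m2 + n2 + pole_shift i
      - n))"
proof -
  from assms consider "i = 0" | "i = 1" by linarith
  then show ?thesis
    unfolding Yplus_elt Yplus_elt_def Let_def lookup_minus lookup_sum_single_diff gbinomial_neg
      mode_coeff_def pole_shift_def
    by cases (auto simp: flip_sign_def algebra_simps ms.scale_left_distrib ms.scale_minus_left)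
qed

lemma mode_add_left: "mode (Yplus i) (f + f') n g = mode (Yplus i) f n g + mode (Yplus i) f' n g"
  by (simp add: Yplus_add_left lookup_add)

lemma mode_add_right: "mode (Yplus i) f n (g + g') = mode (Yplus i) f n g + mode (Yplus i) f n g'"
  by (simp add: Yplus_add_right lookup_add)

lemma mode_mscale_left:
  assumes "i < 2"
  shows "mode (Yplus i) (mscale c f) n g = mscale c (mode (Yplus i) f n g)"
proof (induction f rule: matpoly_induct)
  case (elt u m1 m2)
  show ?case
  proof (induction g rule: matpoly_induct)
    case (elt v n1 n2)
    show ?case
      by (simp add: elt_mat_scale[symmetric] mode_elt[OF assms])
        (simp add: elt_mat_scale mat_scale_mult_left mat_scale_mult_right ms.scale_right_distrib
          mult_ac)
  qed (simp add: mode_add_right ms.scale_right_distrib)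
qed (simp add: mode_add_left ms.scale_right_distrib)

lemma mode_mscale_right:
  assumes "i < 2"
  shows "mode (Yplus i) f n (mscale c g) = mscale c (mode (Yplus i) f n g)"
proof (induction f rule: matpoly_induct)
  case (elt u m1 m2)
  show ?case
  proof (induction g rule: matpoly_induct)
    case (elt v n1 n2)
    show ?case
      by (simp add: elt_mat_scale[symmetric] mode_elt[OF assms])
        (simp add: elt_mat_scale mat_scale_mult_left mat_scale_mult_right ms.scale_right_distrib
          mult_ac)
  qed (simp add: mode_add_right ms.scale_right_distrib)
qed (simp add: mode_add_left ms.scale_right_distrib)

lemma mode_0_left [simp]: "mode (Yplus i) 0 n g = 0"
  using mode_add_left[where f=0 and f'=0] by simp

lemma mode_0_right [simp]: "mode (Yplus i) f n 0 = 0"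
  using mode_add_right[where g=0 and g'=0] by simp

lemma mode_sum_right: "mode (Yplus i) f n (sum F S) = (\<Sum>x\<in>S. mode (Yplus i) f n (F x))"
  by (induction S rule: infinite_finite_induct) (auto simp: mode_add_right)

section \<open>Evaluation and the \<open>\<lambda>\<close>-bracket\<close>

definition mp_eval :: "('f::field_char_0, 'n::finite) matpoly \<Rightarrow> 'f \<Rightarrow> 'f \<Rightarrow> 'f^'n^'n" where
  "mp_eval f x y = (\<Sum>k\<in>Poly_Mapping.keys f.
     mat_scale (x ^ fst k * y ^ snd k / (fact (fst k) * fact (snd k))) (Poly_Mapping.lookup f k))"

lemma mp_eval_add: "mp_eval (f + g) x y = mp_eval f x y + mp_eval g x y"
proof -
  have *: "mp_eval f x y = (\<Sum>k\<in>Poly_Mapping.keys f. (\<lambda>k u.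
      mat_scale (x ^ fst k * y ^ snd k / (fact (fst k) * fact (snd k))) u) k (Poly_Mapping.lookup f k))"
    for f :: "('a, 'b) matpoly"
    by (simp add: mp_eval_def)
  show ?thesis
    unfolding * by (rule setsum_keys_plus_distrib) (auto simp: sm.scale_right_distrib)
qed

lemma mp_eval_elt: "mp_eval (elt u m n) x y = mat_scale (x ^ m * y ^ n / (fact m * fact n)) u"
  by (cases "u = 0") (simp_all add: mp_eval_def elt_def)

lemma mp_eval_0 [simp]: "mp_eval 0 x y = 0"
  by (simp add: mp_eval_def)

lemma mp_eval_mscale: "mp_eval (mscale c f) x y = mat_scale c (mp_eval f x y)"
  by (induction f rule: matpoly_induct)
    (simp_all add: ms.scale_right_distrib sm.scale_right_distrib mp_eval_add elt_mat_scale[symmetric]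
      mp_eval_elt mult_ac)

lemma mp_eval_uminus: "mp_eval (- f) x y = - mp_eval f x y"
  using mp_eval_mscale[of "- 1" f x y] by simp

lemma mp_eval_diff: "mp_eval (f - g) x y = mp_eval f x y - mp_eval g x y"
  using mp_eval_add[of f "- g" x y] by (simp add: mp_eval_uminus)

lemma mp_eval_sum: "mp_eval (sum F S) x y = (\<Sum>k\<in>S. mp_eval (F k) x y)"
  by (induction S rule: infinite_finite_induct) (auto simp: mp_eval_add)

lemma mp_eval_partial: "mp_eval (partial f) x y = mat_scale (x + y) (mp_eval f x y)"
proof (induction f rule: matpoly_induct)
  case (elt u m n)
  have "x * x ^ m * y ^ n * of_nat (m + 1) / (fact (Suc m) * fact n)
    = x * (x ^ m * y ^ n / (fact m * fact n))"
    "x ^ m * (y * y ^ n) * of_nat (n + 1) / (fact m * fact (Suc n))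
      = y * (x ^ m * y ^ n / (fact m * fact n))"
    by (simp_all add: divide_simps del: of_nat_Suc)
  then show ?case
    by (simp add: partial_elt mp_eval_add mp_eval_mscale mp_eval_elt sm.scale_left_distrib[symmetric]
      del: of_nat_Suc)
       (simp add: algebra_simps add_divide_distrib del: of_nat_Suc)
qed (simp add: partial_add mp_eval_add sm.scale_right_distrib)

lemma mp_eval_partial_funpow: "mp_eval ((partial ^^ k) f) x y = mat_scale ((x + y) ^ k) (mp_eval f x y)"
  by (induction k) (simp_all add: mp_eval_partial)

text \<open>Each matrix entry is a polynomial in \<open>l\<close> that vanishes on an infinite
  field, so all its coefficients vanish.\<close>

lemma mat_scale_power_sum_eq_0:
  fixes C :: "nat \<Rightarrow> 'f::field_char_0^'n^'n::finite"
  assumes "\<And>l. (\<Sum>n\<le>K. mat_scale (l ^ n / fact n) (C n)) = 0" and "n \<le> K"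
  shows "C n = 0"
proof -
  have "C n $ p $ q = 0" for p q
  proof -
    define P where "P = (\<Sum>n\<le>K. monom (C n $ p $ q / fact n) n)"
    have "poly P l = 0" for l
    proof -
      have "(\<Sum>n\<le>K. mat_scale (l ^ n / fact n) (C n)) $ p $ q = 0"
        by (simp add: assms(1))
      then show ?thesis
        by (simp add: P_def poly_sum poly_monom mat_scale_def mult_ac)
    qed
    then have "P = 0" using poly_all_0_iff_0[of P] by simp
    then have "coeff P n = 0" by simp
    moreover have "coeff P n = C n $ p $ q / fact n"
      using assms(2) by (simp add: P_def coeff_sum if_distrib cong: if_cong)
    ultimately show ?thesis by simp
  qed
  then show ?thesis by (simp add: vec_eq_iff)
qed

lemma mp_eval_eq_0:
  fixes f :: "('f::field_char_0, 'n::finite) matpoly"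
  assumes "\<And>x y. mp_eval f x y = 0"
  shows "f = 0"
proof (rule poly_mapping_eqI)
  fix k :: "nat \<times> nat"
  obtain m n where k: "k = (m, n)" by fastforce
  \<comment> \<open>A square box that contains the support and also \<open>(m, n)\<close>, so that
    the coefficient at \<open>(m, n)\<close> occurs in the sum. It is then isolated first in
    \<open>x\<close>, afterwards in \<open>y\<close>.\<close>
  obtain K where K: "m \<le> K" "n \<le> K" "Poly_Mapping.keys f \<subseteq> {..K} \<times> {..K}"
  proof -
    define S where "S = insert m (insert n (fst ` Poly_Mapping.keys f \<union> snd ` Poly_Mapping.keys f))"
    define M where "M = Max S"
    have M: "j \<le> M" if "j \<in> S" for j
      unfolding M_def using that by (intro Max_ge) (simp_all add: S_def)
    have "m \<in> S" "n \<in> S" and "\<And>z. z \<in> Poly_Mapping.keys f \<Longrightarrow> fst z \<in> S \<and> snd z \<in> S"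
      by (auto simp: S_def)
    then show ?thesis
      by (intro that[of M] subsetI) (auto simp: mem_Times_iff intro: M)
  qed
  have *: "mp_eval f x y = (\<Sum>m\<le>K. mat_scale (x ^ m / fact m)
      (\<Sum>n\<le>K. mat_scale (y ^ n / fact n) (Poly_Mapping.lookup f (m, n))))" for x y
  proof -
    have "mp_eval f x y = (\<Sum>k\<in>{..K} \<times> {..K}.
        mat_scale (x ^ fst k * y ^ snd k / (fact (fst k) * fact (snd k))) (Poly_Mapping.lookup f k))"
      unfolding mp_eval_def using K by (intro sum.mono_neutral_left) (auto simp: in_keys_iff)
    also have "\<dots> = (\<Sum>m\<le>K. \<Sum>n\<le>K. mat_scale (x ^ m * y ^ n / (fact m * fact n)) (Poly_Mapping.lookup f
      (m, n)))"
      by (subst sum.cartesian_product) (simp add: case_prod_unfold)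
    finally show ?thesis
      by (simp add: sm.scale_sum_right)
  qed
  have "(\<Sum>n\<le>K. mat_scale (y ^ n / fact n) (Poly_Mapping.lookup f (m, n))) = 0" for y
    by (rule mat_scale_power_sum_eq_0[OF _ K(1)]) (simp only: *[symmetric] assms)
  then show "Poly_Mapping.lookup f k = Poly_Mapping.lookup 0 k"
    unfolding k lookup_zero by (rule mat_scale_power_sum_eq_0[OF _ K(2)])
qed

text \<open>Lets an identity between modes be checked on its generating function at points.\<close>

lemma power_sum_mp_eval_eq_0:
  fixes X :: "nat \<Rightarrow> ('f::field_char_0, 'n::finite) matpoly"
  assumes "\<And>l x y. (\<Sum>n\<le>K. mat_scale (l ^ n / fact n) (mp_eval (X n) x y)) = 0" and "n \<le> K"
  shows "X n = 0"
  by (rule mp_eval_eq_0, rule mat_scale_power_sum_eq_0[where K = K]) (use assms in auto)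

section \<open>The bracket of matrix functions that generates the modes\<close>

definition pole_factor :: "nat \<Rightarrow> 'f::field_char_0 \<Rightarrow> 'f" where
  "pole_factor i t = (if i = 0 then t else 1)"

text \<open>The arguments are arbitrary functions rather than elements of the algebra, so brackets
  can be nested.\<close>

definition lambda_bracket :: "nat \<Rightarrow> ('f::field_char_0 \<Rightarrow> 'f \<Rightarrow> 'f^'n^'n::finite) \<Rightarrow> ('f \<Rightarrow> 'f \<Rightarrow> 'f^'n^'n)
    \<Rightarrow> 'f \<Rightarrow> 'f \<Rightarrow> 'f \<Rightarrow> 'f^'n^'n" where
  "lambda_bracket i F G l x y = mat_scale (pole_factor i (l + x)) (F x (- l - x) ** G (l + x) y)
     + mat_scale (flip_sign i * pole_factor i (l + y)) (G x (l + y) ** F (- l - y) y)"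

text \<open>Beyond this index the upper entry of the last binomial drops below \<open>m1\<close>.
  The simplicity proof uses this bound to kill all but the wanted terms.\<close>

lemma mode_coeff_eq_0: "n > m2 + n1 + pole_shift i \<Longrightarrow> mode_coeff i m1 m2 n1 n = 0"
  by (auto simp: mode_coeff_def intro!: binomial_eq_0)

text \<open>After dropping the vanishing terms \<open>n > T\<close>, the factorials cancel to
  \<open>T choose n\<close>, and the binomial theorem gives \<open>x ^ m1 * (l + x) ^ T\<close>. The
  exponent \<open>T\<close> splits into the pole factor, the second variable of the left element and
  the first variable of the right one.\<close>

lemma mode_coeff_sum:
  fixes l x :: "'f::field_char_0"
  assumes "m1 + m2 + n1 + pole_shift i \<le> K"
  shows "(\<Sum>n\<le>K. l ^ n / fact n * (mode_coeff i m1 m2 n1 n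
      * (x ^ (m1 + m2 + n1 + pole_shift i - n) / fact (m1 + m2 + n1 + pole_shift i - n))))
    = pole_factor i (l + x) * (x ^ m1 / fact m1 * ((- l - x) ^ m2 / fact m2)) * ((l
      + x) ^ n1 / fact n1)"
    (is "?L = ?R")
proof -
  define T where "T = m2 + n1 + pole_shift i"
  define A :: 'f where "A = of_nat (n1 * pole_shift i + 1) * (- 1) ^ m2 / (fact m1 * fact m2 * fact (n1
    + pole_shift i))"
  have "?L = (\<Sum>n\<le>T. l ^ n / fact n * (mode_coeff i m1 m2 n1 n
      * (x ^ (m1 + m2 + n1 + pole_shift i - n) / fact (m1 + m2 + n1 + pole_shift i - n))))"
    by (rule sum.mono_neutral_right) (use assms in \<open>auto simp: T_def mode_coeff_eq_0\<close>)
  also have "\<dots> = (\<Sum>n\<le>T. A * x ^ m1 * (of_nat (T choose n) * l ^ n * x ^ (T - n)))"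
  proof (rule sum.cong)
    fix n assume "n \<in> {..T}"
    then have n: "n \<le> T" by simp
    have N: "m1 + m2 + n1 + pole_shift i - n = m1 + (T - n)" "n \<le> m1 + m2 + n1 + pole_shift i"
      "m1 + (T - n) - m1 = T - n" "n1 + pole_shift i + m2 = T" "T - m2 = n1 + pole_shift i" "m2 \<le> T"
      using n by (auto simp: T_def)
    have p: "x ^ (m1 + T - n) = x ^ m1 * x ^ (T - n)"
      using n by (simp flip: power_add)
    show "l ^ n / fact n * (mode_coeff i m1 m2 n1 n
        * (x ^ (m1 + m2 + n1 + pole_shift i - n) / fact (m1 + m2 + n1 + pole_shift i - n)))
      = A * x ^ m1 * (of_nat (T choose n) * l ^ n * x ^ (T - n))"
      unfolding mode_coeff_def N(1,3,4) A_def using n N(2,6)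
      by (simp add: binomial_fact N(5) p mult_ac del: of_nat_Suc of_nat_add of_nat_mult)
  qed simp
  also have "\<dots> = A * x ^ m1 * (l + x) ^ T"
    by (simp add: binomial_ring sum_distrib_left)
  also have "\<dots> = ?R"
  proof -
    have m: "(- l - x) ^ m2 = (- 1) ^ m2 * (l + x) ^ m2"
      by (subst power_mult_distrib[symmetric]) simp
    \<comment> \<open>For \<open>i = 0\<close> the prefactor \<open>n1 + 1\<close> cancels the last
      factor of the shifted factorial.\<close>
    have "of_nat (n1 * pole_shift i + 1) / fact (n1 + pole_shift i) = (1 / fact n1 :: 'f)"
      by (cases "i = 0") (simp_all add: pole_shift_def divide_simps del: of_nat_Suc)
    then have "A = (- 1) ^ m2 / (fact m1 * fact m2) * (1 / fact n1)"
      unfolding A_def by (metis (no_types, lifting) mult.commute times_divide_eq_right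
        times_divide_times_eq mult.right_neutral)
    moreover have "(l + x) ^ T = pole_factor i (l + x) * (l + x) ^ m2 * (l + x) ^ n1"
      by (simp add: T_def pole_shift_def pole_factor_def power_add)
    ultimately show ?thesis
      by (simp add: m)
  qed
  finally show ?thesis .
qed

lemma mode_bounded: "\<exists>K. \<forall>n>K. mode (Yplus i) f n g = 0"
proof -
  have "n \<le> Max (Poly_Mapping.keys (Yplus i f g))" if "mode (Yplus i) f n g \<noteq> 0" for n
    using that by (intro Max_ge) (auto simp: in_keys_iff)
  then show ?thesis by (metis leD)
qed

text \<open>The two sums of the mode give the two products of the bracket; the second one is
  \<open>mode_coeff_sum\<close> with the variables exchanged. The \<open>+ 1\<close> in the bound on
  \<open>K\<close> covers \<open>pole_shift i\<close>.\<close>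

lemma power_sum_mode_elt:
  assumes i: "i < 2" and K: "m1 + m2 + n1 + n2 + 1 \<le> K"
  shows "(\<Sum>n\<le>K. mat_scale (l ^ n / fact n) (mp_eval (mode (Yplus i) (elt u m1 m2) n (elt v n1 n2)) x y))
    = lambda_bracket i (mp_eval (elt u m1 m2)) (mp_eval (elt v n1 n2)) l x y"
proof -
  have d: "pole_shift i \<le> 1" by (simp add: pole_shift_def)
  let ?N1 = "m1 + m2 + n1 + pole_shift i" and ?N2 = "m1 + m2 + n2 + pole_shift i"
  have "(\<Sum>n\<le>K. mat_scale (l ^ n / fact n) (mp_eval (mode (Yplus i) (elt u m1 m2) n (elt v n1 n2)) x y))
    = (\<Sum>n\<le>K. mat_scale (l ^ n / fact n * (mode_coeff i m1 m2 n1 n * (x ^ (?N1 - n) / fact (?N1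
      - n))) * (y ^ n2 / fact n2)) (u ** v)
        + mat_scale (l ^ n / fact n * (mode_coeff i m2 m1 n2 n * (y ^ (?N2 - n) / fact (?N2
          - n))) * (flip_sign i * (x ^ n1 / fact n1))) (v ** u))"
    by (simp add: mode_elt[OF i] mp_eval_add mp_eval_mscale mp_eval_elt sm.scale_right_distrib mult_ac)
  also have "\<dots> = mat_scale ((\<Sum>n\<le>K. l ^ n / fact n * (mode_coeff i m1 m2 n1 n * (x ^ (?N1
    - n) / fact (?N1 - n)))) * (y ^ n2 / fact n2)) (u ** v)
        + mat_scale ((\<Sum>n\<le>K. l ^ n / fact n * (mode_coeff i m2 m1 n2 n * (y ^ (?N2 - n) / fact (?N2
          - n)))) * (flip_sign i * (x ^ n1 / fact n1))) (v ** u)"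
    by (simp only: sum_distrib_right sm.scale_sum_left sum.distrib)
  also have "\<dots> = lambda_bracket i (mp_eval (elt u m1 m2)) (mp_eval (elt v n1 n2)) l x y"
    using mode_coeff_sum[of m1 m2 n1 i K l x] mode_coeff_sum[of m2 m1 n2 i K l y] K d
    by (simp add: lambda_bracket_def mp_eval_elt mat_scale_mult_left mat_scale_mult_right mult_ac
      add_ac)
  finally show ?thesis .
qed

lemma lambda_bracket_add_left: "lambda_bracket i (\<lambda>x y. F x y + F' x y) G l x y
  = lambda_bracket i F G l x y + lambda_bracket i F' G l x y"
  by (simp add: lambda_bracket_def matrix_add_rdistrib matrix_add_ldistrib sm.scale_right_distrib)

lemma lambda_bracket_add_right: "lambda_bracket i F (\<lambda>x y. G x y + G' x y) l x y
  = lambda_bracket i F G l x y + lambda_bracket i F G' l x y"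
  by (simp add: lambda_bracket_def matrix_add_rdistrib matrix_add_ldistrib sm.scale_right_distrib)

lemma lambda_bracket_mat_scale_left: "lambda_bracket i (\<lambda>x y. mat_scale c (F x y)) G l x y
  = mat_scale c (lambda_bracket i F G l x y)"
  by (simp add: lambda_bracket_def mat_scale_mult_left mat_scale_mult_right sm.scale_right_distrib
    mult_ac)

lemma lambda_bracket_mat_scale_right: "lambda_bracket i F (\<lambda>x y. mat_scale c (G x y)) l x y
  = mat_scale c (lambda_bracket i F G l x y)"
  by (simp add: lambda_bracket_def mat_scale_mult_left mat_scale_mult_right sm.scale_right_distrib
    mult_ac)

lemma lambda_bracket_sum_left:
  "lambda_bracket i (\<lambda>x y. \<Sum>n\<in>S. mat_scale (c n) (F n x y)) G l x y
    = (\<Sum>n\<in>S. mat_scale (c n) (lambda_bracket i (F n) G l x y))"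
proof (induction S rule: infinite_finite_induct)
  case (insert a S)
  then show ?case by (simp add: lambda_bracket_add_left lambda_bracket_mat_scale_left)
qed (simp_all add: lambda_bracket_def matrix_zero_left matrix_zero_right)

lemma lambda_bracket_sum_right:
  "lambda_bracket i F (\<lambda>x y. \<Sum>n\<in>S. mat_scale (c n) (G n x y)) l x y
    = (\<Sum>n\<in>S. mat_scale (c n) (lambda_bracket i F (G n) l x y))"
proof (induction S rule: infinite_finite_induct)
  case (insert a S)
  then show ?case by (simp add: lambda_bracket_add_right lambda_bracket_mat_scale_right)
qed (simp_all add: lambda_bracket_def matrix_zero_left matrix_zero_right)

lemma power_sum_mode:
  assumes i: "i < 2" and "\<And>n. n > K \<Longrightarrow> mode (Yplus i) f n g = 0"
  shows "(\<Sum>n\<le>K. mat_scale (l ^ n / fact n) (mp_eval (mode (Yplus i) f n g) x y))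
    = lambda_bracket i (mp_eval f) (mp_eval g) l x y"
proof -
  \<comment> \<open>Equality for all large \<open>K\<close> survives addition, whereas a fixed bound
    valid for a sum need not be valid for its summands.\<close>
  have *: "\<exists>K0. \<forall>K\<ge>K0. (\<Sum>n\<le>K. mat_scale (l ^ n / fact n) (mp_eval (mode (Yplus i) f n g) x y))
      = lambda_bracket i (mp_eval f) (mp_eval g) l x y" (is "\<exists>K0. \<forall>K\<ge>K0. ?P f g K")
  proof (induction f rule: matpoly_induct)
    case (elt u m1 m2)
    show ?case
    proof (induction g rule: matpoly_induct)
      case (elt v n1 n2)
      show ?case using power_sum_mode_elt[OF i] by blast
    next
      case (add g g')
      then obtain K1 K2 where "\<forall>K\<ge>K1. ?P (elt u m1 m2) g K" "\<forall>K\<ge>K2. ?P (elt u m1 m2) g' K"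
        by blast
      then have "\<forall>K\<ge>max K1 K2. ?P (elt u m1 m2) (g + g') K"
        by (simp add: mode_add_right mp_eval_add[abs_def] sm.scale_right_distrib sum.distrib
          lambda_bracket_add_right)
      then show ?case by blast
    qed
  next
    case (add f f')
    then obtain K1 K2 where "\<forall>K\<ge>K1. ?P f g K" "\<forall>K\<ge>K2. ?P f' g K"
      by blast
    then have "\<forall>K\<ge>max K1 K2. ?P (f + f') g K"
      by (simp add: mode_add_left mp_eval_add[abs_def] sm.scale_right_distrib sum.distrib
        lambda_bracket_add_left)
    then show ?case by blast
  qed
  then obtain K0 where K0: "\<forall>K\<ge>K0. ?P f g K" by blast
  have "(\<Sum>n\<le>max K K0. mat_scale (l ^ n / fact n) (mp_eval (mode (Yplus i) f n g) x y))
    = (\<Sum>n\<le>K. mat_scale (l ^ n / fact n) (mp_eval (mode (Yplus i) f n g) x y))"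
    by (rule sum.mono_neutral_right) (auto simp: assms(2))
  with K0 show ?thesis by simp
qed

text \<open>The parity of the pole factor is tied to the sign of the second product; skew-symmetry
  and the Jacobi identity depend on this relation.\<close>

lemma pole_factor_minus: "pole_factor i (- t) = - flip_sign i * pole_factor i t"
  by (simp add: pole_factor_def flip_sign_def)

lemma flip_sign_sq: "flip_sign i * (flip_sign i * c) = c"
  by (simp add: flip_sign_def)

text \<open>Replacing \<open>l\<close> by \<open>- l - x - y\<close> sends \<open>l + x\<close> to
  \<open>- (l + y)\<close> and \<open>l + y\<close> to \<open>- (l + x)\<close>, which exchanges the
  two products up to sign.\<close>

lemma lambda_bracket_skew: "lambda_bracket i F G l x y = - lambda_bracket i G F (- l - x - y) x y"
proof -
  have a: "- l - x - y + x = - (l + y)" "- l - x - y + y = - (l + x)" "- (- l - x - y) - x = l + y"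
    "- (- l - x - y) - y = l + x" by simp_all
  show ?thesis
    unfolding lambda_bracket_def a pole_factor_minus by (simp add: flip_sign_sq minus_diff_eq add_ac)
qed

text \<open>Of the eight products on the left, those with \<open>W\<close> in the middle cancel; the
  four with \<open>W\<close> at an end are those on the right.\<close>

lemma lambda_bracket_jacobi:
  "lambda_bracket i F (lambda_bracket i G W m) l x y - lambda_bracket i G (lambda_bracket i F W l) m x y
    = lambda_bracket i (lambda_bracket i F G l) W (l + m) x y"
proof -
  \<comment> \<open>These equations normalize the nested arguments so that equal products become
    syntactically equal.\<close>
  have arg: "l + (- (l + m) - x) = - (m + x)" "l + (- (l + m) - y) = - (m + y)"
    "- l - (- (l + m) - x) = m + x" "- l - (- (l + m) - y) = m + y"
    "- m - (l + x) = - (l + m) - x" "- m - (l + y) = - (l + m) - y"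
    "- l - (m + x) = - (l + m) - x" "- l - (m + y) = - (l + m) - y"
    "- l - x = - (l + x)" "- m - x = - (m + x)" "- l - y = - (l + y)" "- m - y = - (m + y)"
    "- (l + m) - x = - (l + m + x)" "- (l + m) - y = - (l + m + y)"
    "m + (l + x) = l + m + x" "m + (l + y) = l + m + y" "l + (m + x) = l + m + x" "l + (m + y)
      = l + m + y"
    by simp_all
  have arg': "l - (l + m + x) = - (m + x)" "l - (l + m + y) = - (m + y)"
    "l + - (l + m + x) = - (m + x)" "l + - (l + m + y) = - (m + y)"
    "- l - - (l + m + x) = m + x" "- l - - (l + m + y) = m + y"
    by simp_all
  show ?thesis
    unfolding lambda_bracket_def arg arg' pole_factor_minus
    by (simp only: arg arg' matrix_add_ldistrib matrix_add_rdistrib mat_scale_mult_left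
      mat_scale_mult_right
        sm.scale_right_distrib sm.scale_scale matrix_mul_assoc pole_factor_minus)
      (simp add: flip_sign_sq mult_ac)
qed

section \<open>The conformal algebra axioms\<close>

lemma sum_triangle_swap:
  "(\<Sum>n\<le>K. \<Sum>p\<in>{n..K}. F n p) = (\<Sum>p\<le>(K::nat). \<Sum>n\<le>p. (F n p :: 'a::comm_monoid_add))"
proof -
  have "(\<Sum>n\<le>K. \<Sum>p\<in>{n..K}. F n p) = (\<Sum>(n, p)\<in>Sigma {..K} (\<lambda>n. {n..K}). F n p)"
    by (rule sum.Sigma) auto
  also have "\<dots> = (\<Sum>(p, n)\<in>Sigma {..K} (\<lambda>p. {..p}). F n p)"
    by (rule sum.reindex_bij_witness[of _ "\<lambda>(p, n). (n, p)" "\<lambda>(n, p). (p, n)"]) auto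
  also have "\<dots> = (\<Sum>p\<le>K. \<Sum>n\<le>p. F n p)"
    by (rule sum.Sigma[symmetric]) auto
  finally show ?thesis .
qed

lemma divided_power_add:
  fixes x y :: "'f::field_char_0"
  shows "(x + y) ^ n / fact n = (\<Sum>k\<le>n. x ^ k / fact k * (y ^ (n - k) / fact (n - k)))"
  unfolding binomial_ring sum_divide_distrib by (rule sum.cong) (simp_all add: binomial_fact)

text \<open>In the generating function, the powers of \<open>partial\<close> turn
  \<open>l ^ n\<close> into divided powers of \<open>l + (x + y)\<close>; with the sign this is the
  negated bracket of \<open>v\<close> and \<open>u\<close> at \<open>- l - x - y\<close>.\<close>

lemma mode_skew:
  assumes i: "i < 2"
  shows "mode (Yplus i) u n v = (\<Sum>p | p \<in> Poly_Mapping.keys (Yplus i v u) \<and> n \<le> p.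
     mscale ((- 1) ^ (p + 1) / fact (p - n)) ((partial ^^ (p - n)) (mode (Yplus i) v p u)))"
proof -
  define X where "X n = (\<Sum>p | p \<in> Poly_Mapping.keys (Yplus i v u) \<and> n \<le> p.
     mscale ((- 1) ^ (p + 1) / fact (p - n)) ((partial ^^ (p - n)) (mode (Yplus i) v p u)))" for n
  obtain K1 where K1: "\<forall>n>K1. mode (Yplus i) u n v = 0"
    using mode_bounded by blast
  obtain K2 where K2: "\<forall>n>K2. mode (Yplus i) v n u = 0"
    using mode_bounded by blast
  define K where "K = max n (max K1 K2)"
  have X: "X n = (\<Sum>p\<in>{n..K}. mscale ((- 1) ^ (p + 1) / fact (p - n))
      ((partial ^^ (p - n)) (mode (Yplus i) v p u)))" for n
    unfolding X_def
  proof (rule sum.mono_neutral_left)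
    have "(partial ^^ m) 0 = (0 :: ('a, 'b) matpoly)" for m
      by (induction m) (simp_all add: partial_def)
    then show "\<forall>p\<in>{n..K} - {p \<in> Poly_Mapping.keys (Yplus i v u). n \<le> p}.
      mscale ((- 1) ^ (p + 1) / fact (p - n)) ((partial ^^ (p - n)) (mode (Yplus i) v p u)) = 0"
      by (auto simp: in_keys_iff)
    show "{p \<in> Poly_Mapping.keys (Yplus i v u). n \<le> p} \<subseteq> {n..K}"
      using K2 by (auto simp: in_keys_iff K_def) (metis linorder_not_less max.coboundedI2)
  qed simp
  have "(\<Sum>n\<le>K. mat_scale (l ^ n / fact n) (mp_eval (mode (Yplus i) u n v - X n) x y)) = 0" for l x y
  proof -
    have "(\<Sum>n\<le>K. mat_scale (l ^ n / fact n) (mp_eval (X n) x y))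
      = (\<Sum>n\<le>K. \<Sum>p\<in>{n..K}. mat_scale ((- 1) ^ (p + 1) * (l ^ n / fact n * ((x + y) ^ (p - n) / fact (p
        - n))))
          (mp_eval (mode (Yplus i) v p u) x y))"
      by (simp add: X mp_eval_sum mp_eval_mscale mp_eval_uminus mp_eval_partial_funpow
        sm.scale_sum_right mult_ac)
    also have "\<dots> = (\<Sum>p\<le>K. \<Sum>n\<le>p. mat_scale ((- 1) ^ (p + 1) * (l ^ n / fact n * ((x + y) ^ (p
      - n) / fact (p - n))))
          (mp_eval (mode (Yplus i) v p u) x y))"
      by (rule sum_triangle_swap)
    also have "\<dots> = (\<Sum>p\<le>K. - mat_scale ((- l - x
      - y) ^ p / fact p) (mp_eval (mode (Yplus i) v p u) x y))"
    proof (rule sum.cong)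
      fix p
      have "(- l - x - y) ^ p = (- 1) ^ p * (l + (x + y)) ^ p"
        by (subst power_mult_distrib[symmetric]) (simp add: algebra_simps)
      then show "(\<Sum>n\<le>p. mat_scale ((- 1) ^ (p + 1) * (l ^ n / fact n * ((x + y) ^ (p - n) / fact (p
        - n))))
          (mp_eval (mode (Yplus i) v p u) x y))
            = - mat_scale ((- l - x - y) ^ p / fact p) (mp_eval (mode (Yplus i) v p u) x y)"
        unfolding sm.scale_sum_left[symmetric] sum_distrib_left[symmetric] divided_power_add[symmetric]
          by simp
    qed simp
    also have "\<dots> = - lambda_bracket i (mp_eval v) (mp_eval u) (- l - x - y) x y"
      unfolding sum_negf by (subst power_sum_mode[OF i]) (use K2 in \<open>auto simp: K_def\<close>)
    also have "\<dots> = lambda_bracket i (mp_eval u) (mp_eval v) l x y"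
      by (rule lambda_bracket_skew[symmetric])
    also have "\<dots> = (\<Sum>n\<le>K. mat_scale (l ^ n / fact n) (mp_eval (mode (Yplus i) u n v) x y))"
      by (subst power_sum_mode[OF i]) (use K1 in \<open>auto simp: K_def\<close>)
    finally show ?thesis
      by (simp add: mp_eval_diff sm.scale_right_diff_distrib sum_subtractf)
  qed
  then have "mode (Yplus i) u n v - X n = 0"
    by (rule power_sum_mp_eval_eq_0) (simp add: K_def)
  then show ?thesis by (simp add: X_def)
qed

text \<open>In both products of the bracket the two arguments of the left function add up to
  \<open>- l\<close>, so \<open>partial\<close> multiplies the bracket by \<open>- l\<close>. On
  modes this is the shift of the index; at \<open>n = 0\<close> the coefficient is 0.\<close>

lemma mode_partial_left:
  assumes i: "i < 2"
  shows "mode (Yplus i) (partial u) n v = mscale (- of_nat n) (mode (Yplus i) u (n - 1) v)"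
proof -
  obtain K1 where K1: "\<forall>n>K1. mode (Yplus i) (partial u) n v = 0"
    using mode_bounded by blast
  obtain K2 where K2: "\<forall>n>K2. mode (Yplus i) u n v = 0"
    using mode_bounded by blast
  define K where "K = max n (max K1 K2)"
  \<comment> \<open>The range ends at \<open>Suc K\<close> because the shift moves index
    \<open>K\<close> to \<open>Suc K\<close>.\<close>
  have "(\<Sum>n\<le>Suc K. mat_scale (l ^ n / fact n) (mp_eval (mode (Yplus i) (partial u) n v
      - mscale (- of_nat n) (mode (Yplus i) u (n - 1) v)) x y)) = 0" for l x y
  proof -
    have "(\<Sum>n\<le>Suc K. mat_scale (l ^ n / fact n) (mp_eval (mscale (- of_nat n) (mode (Yplus i) u (n
      - 1) v)) x y))
      = (\<Sum>n\<le>K. mat_scale (l ^ Suc n / fact (Suc n) *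
        - of_nat (Suc n)) (mp_eval (mode (Yplus i) u n v) x y))"
      by (simp add: sum.atMost_Suc_shift mp_eval_mscale mp_eval_uminus del: sum.atMost_Suc of_nat_Suc
        fact_Suc)
    also have "\<dots> = mat_scale (- l) (\<Sum>n\<le>K. mat_scale (l ^ n / fact n) (mp_eval (mode
      (Yplus i) u n v) x y))"
      unfolding sm.scale_sum_right sm.scale_scale
      by (intro sum.cong refl arg_cong2[where f
        = mat_scale]) (simp_all add: divide_simps del: of_nat_Suc)
    also have "\<dots> = mat_scale (- l) (lambda_bracket i (mp_eval u) (mp_eval v) l x y)"
      by (subst power_sum_mode[OF i]) (use K2 in \<open>auto simp: K_def\<close>)
    also have "\<dots> = lambda_bracket i (mp_eval (partial u)) (mp_eval v) l x y"
      by (simp add: lambda_bracket_def mp_eval_partial mat_scale_mult_left mat_scale_mult_right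
        sm.scale_right_distrib
          mult_ac del: sm.scale_minus_left)
    also have "\<dots> = (\<Sum>n\<le>Suc K. mat_scale (l ^ n / fact n) (mp_eval (mode (Yplus i)
      (partial u) n v) x y))"
      by (subst power_sum_mode[OF i]) (use K1 in \<open>auto simp: K_def\<close>)
    finally show ?thesis
      by (simp only: mp_eval_diff sm.scale_right_diff_distrib sum_subtractf diff_self)
  qed
  then have "mode (Yplus i) (partial u) n v - mscale (- of_nat n) (mode (Yplus i) u (n - 1) v) = 0"
    by (rule power_sum_mp_eval_eq_0) (simp add: K_def)
  then show ?thesis by (simp only: right_minus_eq)
qed

text \<open>With \<open>s = m + n - p\<close> and \<open>a = m - p\<close>, the weight factors into
  divided powers of \<open>l\<close>, \<open>l\<close> and \<open>k\<close> with exponents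
  \<open>p\<close>, \<open>a\<close> and \<open>s - a\<close>; summing over \<open>a\<close> gives
  the divided power of \<open>l + k\<close>.\<close>

lemma binomial_reindex:
  fixes c :: "nat \<Rightarrow> nat \<Rightarrow> 'f::field_char_0^'n^'n::finite"
  assumes c: "\<And>p s. p + s > K \<Longrightarrow> c p s = 0"
  shows "(\<Sum>m\<le>K. \<Sum>n\<le>K. \<Sum>p\<le>m. mat_scale (l ^ m / fact m * (k ^ n / fact n) * of_nat (m choose p)) (c p (m
    + n - p)))
    = (\<Sum>p\<le>K. \<Sum>s\<le>K. mat_scale (l ^ p / fact p * ((l + k) ^ s / fact s)) (c p s))"
proof -
  let ?A = "Sigma {..K} (\<lambda>m. Sigma {..K} (\<lambda>n. {..m}))"
  let ?B = "Sigma {..K} (\<lambda>p. Sigma {..K} (\<lambda>s. {..s}))"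
  have "(\<Sum>p\<le>K. \<Sum>s\<le>K. mat_scale (l ^ p / fact p * ((l + k) ^ s / fact s)) (c p s))
    = (\<Sum>p\<le>K. \<Sum>s\<le>K. \<Sum>a\<le>s. mat_scale (l ^ p / fact p * (l ^ a / fact a * (k ^ (s - a) / fact (s
      - a)))) (c p s))"
  proof (intro sum.cong refl)
    fix p s
    show "mat_scale (l ^ p / fact p * ((l + k) ^ s / fact s)) (c p s)
      = (\<Sum>a\<le>s. mat_scale (l ^ p / fact p * (l ^ a / fact a * (k ^ (s - a) / fact (s - a)))) (c p s))"
      by (simp only: sm.scale_sum_left sum_distrib_left divided_power_add)
  qed
  also have "\<dots> = (\<Sum>(p, s, a)\<in>?B. mat_scale (l ^ p / fact p * (l ^ a / fact a * (k ^ (s - a) / fact (s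
    - a)))) (c p s))"
    by (simp add: sum.Sigma)
  also have "\<dots> = (\<Sum>(m, n, p)\<in>?A. mat_scale (l ^ m / fact m * (k ^ n / fact n) * of_nat (m choose p))
    (c p (m + n - p)))"
  \<comment> \<open>The index boxes do not correspond exactly; the mismatch lies where
    \<open>p + s = m + n\<close> exceeds \<open>K\<close>, and there \<open>c\<close>
    vanishes.\<close>
  proof (rule sum.reindex_bij_witness_not_neutral[where S' = "{(p, s, a) \<in> ?B. p + s > K}"
      and T' = "{(m, n, p) \<in> ?A. m + n > K}" and i = "\<lambda>(m, n, p). (p, m + n - p, m - p)"
      and j = "\<lambda>(p, s, a). (p + a, s - a, p)"])
    show "finite {(p, s, a) \<in> ?B. p + s > K}" by (rule finite_subset[of _ ?B]) auto
    show "finite {(m, n, p) \<in> ?A. m + n > K}" by (rule finite_subset[of _ ?A]) auto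
  next
    fix z assume z: "z \<in> ?B"
    obtain p s a where [simp]: "z = (p, s, a)" by (cases z)
    from z have *: "a \<le> s" by auto
    have "l ^ (p + a) / fact (p + a) * (k ^ (s - a) / fact (s - a)) * of_nat ((p + a) choose p)
      = l ^ p / fact p * (l ^ a / fact a * (k ^ (s - a) / fact (s - a)))"
      by (simp add: binomial_fact power_add mult_ac)
    with * show "(case case z of (p, s, a) \<Rightarrow> (p + a, s - a, p) of (m, n, p) \<Rightarrow>
        mat_scale (l ^ m / fact m * (k ^ n / fact n) * of_nat (m choose p)) (c p (m + n - p)))
      = (case z of (p, s, a) \<Rightarrow> mat_scale (l ^ p / fact p * (l ^ a / fact a * (k ^ (s - a) / fact (s
        - a)))) (c p s))"
      by simp
  qed (auto simp: c)
  also have "\<dots> = (\<Sum>m\<le>K. \<Sum>n\<le>K. \<Sum>p\<le>m. mat_scale (l ^ m / fact m * (k ^ n / fact n) * of_nat (m choose p))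
    (c p (m + n - p)))"
    by (simp add: sum.Sigma)
  finally show ?thesis by simp
qed

text \<open>The bound is uniform: only finitely many inner modes are nonzero, so the maximum of
  their outer bounds suffices.\<close>

lemma mode_mode_bounded_right:
  "\<exists>K. \<forall>n m. n > K \<or> m > K \<longrightarrow> mode (Yplus i) f m (mode (Yplus i) g n w) = 0"
proof -
  obtain K0 where K0: "\<forall>n>K0. mode (Yplus i) g n w = 0" using mode_bounded by blast
  have "\<forall>n. \<exists>K. \<forall>m>K. mode (Yplus i) f m (mode (Yplus i) g n w) = 0"
    using mode_bounded by blast
  then obtain k where k: "\<forall>n. \<forall>m>k n. mode (Yplus i) f m (mode (Yplus i) g n w) = 0" by metis
  define K where "K = max K0 (Max (k ` {..K0}))"
  have "mode (Yplus i) f m (mode (Yplus i) g n w) = 0" if "n > K \<or> m > K" for m n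
  proof (cases "n \<le> K0")
    case True
    then have "k n \<le> Max (k ` {..K0})" by (intro Max_ge) auto
    then have "k n \<le> K" by (simp add: K_def)
    with k True that show ?thesis by (auto simp: K_def)
  next
    case False
    then show ?thesis using K0 by simp
  qed
  then show ?thesis by blast
qed

lemma mode_mode_bounded_left:
  "\<exists>K. \<forall>p s. p + s > K \<longrightarrow> mode (Yplus i) (mode (Yplus i) f p g) s w = 0"
proof -
  obtain K0 where K0: "\<forall>n>K0. mode (Yplus i) f n g = 0" using mode_bounded by blast
  have "\<forall>p. \<exists>K. \<forall>s>K. mode (Yplus i) (mode (Yplus i) f p g) s w = 0"
    using mode_bounded by blast
  then obtain k where k: "\<forall>p. \<forall>s>k p. mode (Yplus i) (mode (Yplus i) f p g) s w = 0" by metis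
  define K where "K = K0 + Max (k ` {..K0})"
  have "mode (Yplus i) (mode (Yplus i) f p g) s w = 0" if "p + s > K" for p s
  proof (cases "p \<le> K0")
    case True
    then have "k p \<le> Max (k ` {..K0})" by (intro Max_ge) auto
    then have "s > k p" using that True unfolding K_def by linarith
    with k show ?thesis by auto
  next
    case False
    then show ?thesis using K0 by simp
  qed
  then show ?thesis by blast
qed

text \<open>The double generating function in \<open>l\<close> and \<open>k\<close> turns each term
  into an iterated bracket; the binomial sum becomes the bracket with parameter
  \<open>l + k\<close>. Two coefficient comparisons then return to the modes.\<close>

lemma mode_jacobi:
  assumes i: "i < 2"
  shows "mode (Yplus i) u m (mode (Yplus i) v n w) - mode (Yplus i) v n (mode (Yplus i) u m w)
    = (\<Sum>p\<le>m. mscale (of_nat (m choose p)) (mode (Yplus i) (mode (Yplus i) u p v) (m + n - p) w))"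
proof -
  define X where "X m n = mode (Yplus i) u m (mode (Yplus i) v n w)
    - mode (Yplus i) v n (mode (Yplus i) u m w)
    - (\<Sum>p\<le>m. mscale (of_nat (m choose p)) (mode (Yplus i) (mode (Yplus i) u p v) (m + n
      - p) w))" for m n
  obtain K1 where K1: "\<forall>n m. n > K1 \<or> m > K1 \<longrightarrow> mode (Yplus i) u m (mode (Yplus i) v n w) = 0"
    using mode_mode_bounded_right by blast
  obtain K2 where K2: "\<forall>n m. n > K2 \<or> m > K2 \<longrightarrow> mode (Yplus i) v m (mode (Yplus i) u n w) = 0"
    using mode_mode_bounded_right by blast
  obtain K3 where K3: "\<forall>p s. p + s > K3 \<longrightarrow> mode (Yplus i) (mode (Yplus i) u p v) s w = 0"
    using mode_mode_bounded_left by blast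
  obtain K4 where K4: "\<forall>n>K4. mode (Yplus i) v n w = 0"
    using mode_bounded by blast
  obtain K5 where K5: "\<forall>n>K5. mode (Yplus i) u n w = 0"
    using mode_bounded by blast
  obtain K6 where K6: "\<forall>n>K6. mode (Yplus i) u n v = 0"
    using mode_bounded by blast
  define K where "K = Max {m, n, K1, K2, K3, K4, K5, K6}"
  have K: "m \<le> K" "n \<le> K" "K1 \<le> K" "K2 \<le> K" "K3 \<le> K" "K4 \<le> K" "K5 \<le> K" "K6 \<le> K"
    unfolding K_def by (rule Max_ge; simp)+
  have sum: "(\<Sum>m\<le>K. mat_scale (l ^ m / fact m) (\<Sum>n\<le>K. mat_scale (k ^ n / fact n) (mp_eval (X m n) x y)))
    = 0" for l k x y
  proof -
    have "(\<Sum>m\<le>K. mat_scale (l ^ m / fact m) (\<Sum>n\<le>K. mat_scale (k ^ n / fact n)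
        (mp_eval (mode (Yplus i) u m (mode (Yplus i) v n w)) x y)))
      = (\<Sum>n\<le>K. mat_scale (k ^ n / fact n) (\<Sum>m\<le>K. mat_scale (l ^ m / fact m)
        (mp_eval (mode (Yplus i) u m (mode (Yplus i) v n w)) x y)))"
      \<comment> \<open>The outer mode has index \<open>m\<close>, so the sum over \<open>m\<close>
        must become the inner one before \<open>power_sum_mode\<close> applies.\<close>
      unfolding sm.scale_sum_right by (subst sum.swap) (simp add: mult_ac)
    also have "\<dots> = (\<Sum>n\<le>K. mat_scale (k ^ n / fact n) (lambda_bracket i (mp_eval u) (mp_eval (mode
      (Yplus i) v n w)) l x y))"
      by (intro sum.cong refl arg_cong2[where f = mat_scale] power_sum_mode i) (use K K1 in auto)
    also have "\<dots> = lambda_bracket i (mp_eval u) (lambda_bracket i (mp_eval v) (mp_eval w) k) l x y"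
      unfolding lambda_bracket_sum_right[symmetric]
      by (subst power_sum_mode[OF i]) (use K K4 in auto)
    finally have 1: "(\<Sum>m\<le>K. mat_scale (l ^ m / fact m) (\<Sum>n\<le>K. mat_scale (k ^ n / fact n)
        (mp_eval (mode (Yplus i) u m (mode (Yplus i) v n w)) x y)))
          = lambda_bracket i (mp_eval u) (lambda_bracket i (mp_eval v) (mp_eval w) k) l x y" .
    have "(\<Sum>m\<le>K. mat_scale (l ^ m / fact m) (\<Sum>n\<le>K. mat_scale (k ^ n / fact n)
        (mp_eval (mode (Yplus i) v n (mode (Yplus i) u m w)) x y)))
      = (\<Sum>m\<le>K. mat_scale (l ^ m / fact m) (lambda_bracket i (mp_eval v) (mp_eval (mode
        (Yplus i) u m w)) k x y))"
      by (intro sum.cong refl arg_cong2[where f = mat_scale] power_sum_mode i) (use K K2 in auto)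
    also have "\<dots> = lambda_bracket i (mp_eval v) (lambda_bracket i (mp_eval u) (mp_eval w) l) k x y"
      unfolding lambda_bracket_sum_right[symmetric]
      by (subst power_sum_mode[OF i]) (use K K5 in auto)
    finally have 2: "(\<Sum>m\<le>K. mat_scale (l ^ m / fact m) (\<Sum>n\<le>K. mat_scale (k ^ n / fact n)
        (mp_eval (mode (Yplus i) v n (mode (Yplus i) u m w)) x y)))
          = lambda_bracket i (mp_eval v) (lambda_bracket i (mp_eval u) (mp_eval w) l) k x y" .
    have "(\<Sum>m\<le>K. mat_scale (l ^ m / fact m) (\<Sum>n\<le>K. mat_scale (k ^ n / fact n)
        (mp_eval (\<Sum>p\<le>m. mscale (of_nat (m choose p)) (mode (Yplus i) (mode (Yplus i) u p v) (m + n
          - p) w)) x y)))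
      = (\<Sum>m\<le>K. \<Sum>n\<le>K. \<Sum>p\<le>m. mat_scale (l ^ m / fact m * (k ^ n / fact n) * of_nat (m choose p))
          (mp_eval (mode (Yplus i) (mode (Yplus i) u p v) (m + n - p) w) x y))"
      by (simp add: mp_eval_sum mp_eval_mscale sm.scale_sum_right mult_ac)
    also have "\<dots> = (\<Sum>p\<le>K. \<Sum>s\<le>K. mat_scale (l ^ p / fact p * ((l + k) ^ s / fact s))
          (mp_eval (mode (Yplus i) (mode (Yplus i) u p v) s w) x y))"
      by (rule binomial_reindex) (use K K3 in auto)
    also have "\<dots> = (\<Sum>p\<le>K. mat_scale (l ^ p / fact p) (\<Sum>s\<le>K. mat_scale ((l + k) ^ s / fact s)
          (mp_eval (mode (Yplus i) (mode (Yplus i) u p v) s w) x y)))"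
      by (simp add: sm.scale_sum_right)
    also have "\<dots> = (\<Sum>p\<le>K. mat_scale (l ^ p / fact p) (lambda_bracket i (mp_eval (mode (Yplus i) u p v))
      (mp_eval w) (l + k) x y))"
      by (intro sum.cong refl arg_cong2[where f = mat_scale] power_sum_mode i) (use K K3 in auto)
    also have "\<dots> = lambda_bracket i (lambda_bracket i (mp_eval u) (mp_eval v) l) (mp_eval w) (l
      + k) x y"
      unfolding lambda_bracket_sum_left[symmetric]
      by (subst power_sum_mode[OF i]) (use K K6 in auto)
    finally have 3: "(\<Sum>m\<le>K. mat_scale (l ^ m / fact m) (\<Sum>n\<le>K. mat_scale (k ^ n / fact n)
        (mp_eval (\<Sum>p\<le>m. mscale (of_nat (m choose p)) (mode (Yplus i) (mode (Yplus i) u p v) (m + n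
          - p) w)) x y)))
      = lambda_bracket i (lambda_bracket i (mp_eval u) (mp_eval v) l) (mp_eval w) (l + k) x y" .
    show ?thesis
      unfolding X_def mp_eval_diff sm.scale_right_diff_distrib sum_subtractf 1 2 3
        lambda_bracket_jacobi[symmetric] by simp
  qed
  have "X m n = 0"
    by (rule mp_eval_eq_0, rule mat_scale_power_sum_eq_0[OF _ K(2)], rule mat_scale_power_sum_eq_0[OF _
      K(1)], rule sum)
  then show ?thesis by (simp add: X_def)
qed

section \<open>The twisted transposition and its fixed set\<close>

definition flip :: "nat \<Rightarrow> ('f::field_char_0, 'n::finite) matpoly \<Rightarrow> ('f, 'n) matpoly" where
  "flip i f = (\<Sum>k\<in>Poly_Mapping.keys f.
     elt (mat_scale (flip_sign i) (transpose (Poly_Mapping.lookup f k))) (snd k) (fst k))"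

lemma transpose_0 [simp]: "transpose 0 = (0 :: 'a::zero^'n^'m)"
  by (simp add: vec_eq_iff transpose_def)

lemma flip_add: "flip i (f + g) = flip i f + flip i g"
proof -
  have *: "flip i f = (\<Sum>k\<in>Poly_Mapping.keys f. (\<lambda>k u. elt (mat_scale (flip_sign i) (transpose u))
    (snd k) (fst k))
      k (Poly_Mapping.lookup f k))"
    for f :: "('a, 'b) matpoly"
    by (simp add: flip_def)
  show ?thesis
    unfolding * by (rule setsum_keys_plus_distrib)
      (auto simp: transpose_add sm.scale_right_distrib elt_add)
qed

lemma flip_elt: "flip i (elt u m n) = elt (mat_scale (flip_sign i) (transpose u)) n m"
  by (cases "u = 0") (simp_all add: flip_def elt_def)

lemma flip_0 [simp]: "flip i 0 = 0"
  by (simp add: flip_def)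

lemma flip_mscale: "flip i (mscale c f) = mscale c (flip i f)"
  by (induction f rule: matpoly_induct)
    (simp_all add: ms.scale_right_distrib flip_add elt_mat_scale[symmetric] flip_elt transpose_mat_scale
      mult_ac)

lemma flip_sum: "flip i (sum F S) = (\<Sum>k\<in>S. flip i (F k))"
  by (induction S rule: infinite_finite_induct) (auto simp: flip_add)

lemma flip_flip [simp]: "flip i (flip i f) = f"
  by (induction f rule: matpoly_induct)
    (simp_all add: flip_add flip_elt transpose_mat_scale transpose_transpose flip_sign_sq[of _ 1,
      simplified])

lemma flip_partial: "flip i (partial f) = partial (flip i f)"
  by (induction f rule: matpoly_induct)
    (simp_all add: flip_add partial_add flip_elt partial_elt flip_mscale add_ac)

text \<open>Transposition reverses matrix products and so exchanges the two sums of the mode; the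
  sign in \<open>flip\<close> matches the sign of the second sum.\<close>

lemma flip_mode:
  assumes i: "i < 2"
  shows "flip i (mode (Yplus i) f n g) = mode (Yplus i) (flip i f) n (flip i g)"
proof (induction f rule: matpoly_induct)
  case (elt u m1 m2)
  show ?case
  proof (induction g rule: matpoly_induct)
    case (elt v n1 n2)
    show ?case
      by (simp add: flip_elt mode_elt[OF i] flip_add flip_mscale transpose_mult mat_scale_mult_left
          mat_scale_mult_right elt_mat_scale mode_mscale_left[OF i] mode_mscale_right[OF i] mult_ac
            flip_sign_sq flip_sign_sq[of _ 1, simplified] add_ac)
  qed (simp add: mode_add_right flip_add)
qed (simp add: mode_add_left flip_add)

lemma lookup_elt: "Poly_Mapping.lookup (elt u m n) k = (if k = (m, n) then u else 0)"
  by (simp add: elt_def lookup_single when_def)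

definition flip_fixed :: "nat \<Rightarrow> ('f::field_char_0, 'n::finite) matpoly set" where
  "flip_fixed i = {f. flip i f = f}"

definition symm :: "nat \<Rightarrow> ('f::field_char_0, 'n::finite) matpoly \<Rightarrow> ('f, 'n) matpoly" where
  "symm i f = f + flip i f"

lemma subspace_flip_fixed: "ms.subspace (flip_fixed i)"
  by (auto simp: ms.subspace_def flip_fixed_def flip_add flip_mscale)

lemma symm_in_flip_fixed [simp]: "symm i f \<in> flip_fixed i"
  by (simp add: symm_def flip_fixed_def flip_add)

lemma symm_add: "symm i (f + g) = symm i f + symm i g"
  by (simp add: symm_def flip_add)

lemma symm_mscale: "symm i (mscale c f) = mscale c (symm i f)"
  by (simp add: symm_def flip_mscale ms.scale_right_distrib)

lemma symm_sum: "symm i (sum F S) = (\<Sum>k\<in>S. symm i (F k))"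
  by (simp add: symm_def flip_sum sum.distrib)

lemma symm_flip: "symm i (flip i f) = symm i f"
  by (simp add: symm_def add.commute)

lemma flip_fixed_eq_symm: "f \<in> flip_fixed i \<Longrightarrow> f = mscale (1/2) (symm i f)"
  using ms.scale_left_distrib[of "1/2" "1/2" f]
    by (simp only: flip_fixed_def symm_def mem_Collect_eq ms.scale_right_distrib) simp

lemma matrix_expand: "u = (\<Sum>p\<in>UNIV. \<Sum>q\<in>UNIV. mat_scale (u $ p $ q) (matunit p q))"
proof -
  have "(\<Sum>p\<in>UNIV. \<Sum>q\<in>UNIV. mat_scale (u $ p $ q) (matunit p q)) $ i $ j = u $ i $ j" for i j
  proof -
    have "(\<Sum>p\<in>UNIV. \<Sum>q\<in>UNIV. mat_scale (u $ p $ q) (matunit p q)) $ i $ j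
      = (\<Sum>p\<in>UNIV. \<Sum>q\<in>UNIV. if q = j then (if p = i then u $ i $ j else 0) else 0)"
      unfolding sum_component by (intro sum.cong refl) (auto simp: matunit_def mat_scale_def)
    then show ?thesis by simp
  qed
  then show ?thesis by (simp add: vec_eq_iff)
qed

text \<open>Every fixed element is half its own symmetrization, and symmetrization is linear, so
  matrix units suffice. This identifies the fixed sets with the spans that define the two
  algebras.\<close>

lemma flip_fixed_eq_span:
  "flip_fixed i = ms.span {symm i (elt (matunit p q) m n) |p q m n. True}" (is "_ = ms.span ?B")
proof
  show "ms.span ?B \<subseteq> flip_fixed i"
    by (rule ms.span_minimal) (auto simp: subspace_flip_fixed)
  have "symm i f \<in> ms.span ?B" for f
  proof (induction f rule: matpoly_induct)
    case (elt u m n)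
    have "symm i (elt u m n) = (\<Sum>p\<in>UNIV. \<Sum>q\<in>UNIV. mscale (u $ p $ q) (symm i (elt (matunit p q) m n)))"
      by (subst (1) matrix_expand[of u]) (simp only: elt_sum symm_sum elt_mat_scale symm_mscale)
    also have "\<dots> \<in> ms.span ?B"
      by (intro ms.span_sum ms.span_scale ms.span_base) blast
    finally show ?case .
  qed (simp add: symm_add ms.span_add)
  then show "flip_fixed i \<subseteq> ms.span ?B"
    by (intro subsetI, subst flip_fixed_eq_symm) (blast intro: ms.span_scale)+
qed

lemma partial_0: "partial 0 = 0"
  by (simp add: partial_def)

lemma conformal_algebra_flip_fixed:
  assumes i: "i < 2"
  shows "conformal_algebra mscale (flip_fixed i) partial (Yplus i)"
  unfolding conformal_algebra_def
proof (rule conformal_superalgebra.intro[OF vector_space_mscale], rule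
  conformal_superalgebra_axioms.intro,
    goal_cases)
  case (5 j u)
  then show ?case by (auto simp: flip_fixed_def flip_partial partial_0 split: if_splits)
next
  case (10 j k u v n)
  then show ?case by (auto simp: flip_fixed_def flip_mode[OF i] split: if_splits)
next
  case (12 j k u v n)
  \<comment> \<open>The odd part is zero: the sign can differ from 1 only when both elements are
    odd, hence 0.\<close>
  then have "(- 1) ^ (j * k) = (1 :: 'a) \<or> u = 0 \<and> v = 0"
    by (cases "j = 0"; cases "k = 0") auto
  then show ?case
  proof
    assume *: "(- 1) ^ (j * k) = (1 :: 'a)"
    show ?case unfolding * ms.scale_one by (rule mode_skew[OF i])
  qed (simp add: Yplus_def)
next
  case (13 j k u v w m n)
  then have "(- 1) ^ (j * k) = (1 :: 'a) \<or> u = 0 \<and> v = 0"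
    by (cases "j = 0"; cases "k = 0") auto
  then show ?case
  proof
    assume *: "(- 1) ^ (j * k) = (1 :: 'a)"
    show ?case unfolding * ms.scale_one by (rule mode_jacobi[OF i])
  qed simp
qed (auto simp: subspace_flip_fixed ms.subspace_0 partial_add partial_mscale
    mode_add_left mode_add_right mode_mscale_left[OF i] mode_mscale_right[OF i] mode_partial_left[OF i])

section \<open>Simplicity\<close>

text \<open>Allows a mode to be computed on one monomial and symmetrized afterwards.\<close>

lemma symm_mode_left:
  assumes "i < 2" and "g \<in> flip_fixed i"
  shows "mode (Yplus i) (symm i f) n g = symm i (mode (Yplus i) f n g)"
  using assms by (simp add: symm_def mode_add_left flip_mode flip_fixed_def)

lemma symm_mode_right:
  assumes "i < 2" and "f \<in> flip_fixed i"
  shows "mode (Yplus i) f n (symm i g) = symm i (mode (Yplus i) f n g)"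
  using assms by (simp add: symm_def mode_add_right flip_mode flip_fixed_def)

lemma flip_fixed_closed:
  assumes "i < 2"
  shows "f \<in> flip_fixed i \<Longrightarrow> partial f \<in> flip_fixed i"
    and "\<lbrakk>f \<in> flip_fixed i; g \<in> flip_fixed i\<rbrakk> \<Longrightarrow> mode (Yplus i) f n g \<in> flip_fixed i"
  by (simp_all add: flip_fixed_def flip_partial flip_mode assms)

lemma transpose_matunit [simp]: "transpose (matunit p q) = matunit q p"
  by (auto simp: vec_eq_iff transpose_def matunit_def)

lemma matunit_mult: "matunit p q ** matunit r s = (if q = r then matunit p s else 0)"
proof -
  have "(\<Sum>k\<in>UNIV. (if i = p \<and> k = q then 1 else 0) * (if k = r \<and> j = s then 1 else 0))
    = (\<Sum>k\<in>UNIV. if k = q then (if i = p \<and> q = r \<and> j = s then 1 else 0) else (0::'a))" for i j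
    by (rule sum.cong) auto
  then show ?thesis
    by (auto simp: vec_eq_iff matrix_matrix_mult_def matunit_def)
qed

text \<open>Isolates one entry of \<open>A\<close> and moves it to any position; this is the
  simplicity of the matrix algebra in explicit form.\<close>

lemma matunit_sandwich: "matunit p r ** A ** matunit s q = mat_scale (A $ r $ s) (matunit p q)"
proof -
  have "matunit p r ** A ** matunit s q
    = (\<Sum>j\<in>UNIV. \<Sum>k\<in>UNIV. mat_scale (A $ j $ k) (matunit p r ** matunit j k ** matunit s q))"
    by (subst (1) matrix_expand[of A])
      (simp only: matrix_sum_left matrix_sum_right mat_scale_mult_left mat_scale_mult_right)
  also have "\<dots> = (\<Sum>j\<in>UNIV. \<Sum>k\<in>UNIV. if k = s then (if j
    = r then mat_scale (A $ r $ s) (matunit p q) else 0) else 0)"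
    by (intro sum.cong refl) (auto simp: matunit_mult matrix_zero_left)
  finally show ?thesis by simp
qed

lemma matpoly_expand_box:
  assumes "Poly_Mapping.keys f \<subseteq> {..A} \<times> {..B}"
  shows "f = (\<Sum>m\<le>A. \<Sum>n\<le>B. elt (Poly_Mapping.lookup f (m, n)) m n)"
proof -
  have "f = (\<Sum>x\<in>Poly_Mapping.keys f. elt (Poly_Mapping.lookup f x) (fst x) (snd x))"
    by (rule matpoly_expand)
  also have "\<dots> = (\<Sum>x\<in>{..A} \<times> {..B}. elt (Poly_Mapping.lookup f x) (fst x) (snd x))"
    by (rule sum.mono_neutral_left) (use assms in \<open>auto simp: in_keys_iff\<close>)
  also have "\<dots> = (\<Sum>m\<le>A. \<Sum>n\<le>B. elt (Poly_Mapping.lookup f (m, n)) m n)"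
    by (subst sum.cartesian_product) (simp add: case_prod_unfold)
  finally show ?thesis .
qed

text \<open>At the largest index allowed by \<open>mode_coeff_eq_0\<close>, the last binomial is
  \<open>m1 choose m1\<close>, and the other factors are nonzero in characteristic 0.\<close>

lemma mode_coeff_top_neq_0: "mode_coeff i m1 m2 n1 (m2 + n1 + pole_shift i) \<noteq> (0 :: 'f::field_char_0)"
proof -
  have "m1 + m2 + n1 + pole_shift i - (m2 + n1 + pole_shift i) = m1" by simp
  moreover have "of_nat (n1 * pole_shift i + 1) \<noteq> (0 :: 'f)"
    by (simp del: of_nat_Suc of_nat_add)
  ultimately show ?thesis
    unfolding mode_coeff_def by (simp add: binomial_eq_0_iff del: of_nat_Suc of_nat_add)
qed

lemma leading_key:
  fixes f :: "('f::field_char_0, 'n::finite) matpoly"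
  assumes "f \<noteq> 0"
  obtains a B b where "Poly_Mapping.keys f \<subseteq> {..a} \<times> {..B}" "b \<le> B"
    "Poly_Mapping.lookup f (a, b) \<noteq> 0" "\<And>k. k > b \<Longrightarrow> Poly_Mapping.lookup f (a, k) = 0"
proof -
  have ne: "Poly_Mapping.keys f \<noteq> {}" using assms by auto
  define a where "a = Max (fst ` Poly_Mapping.keys f)"
  define B where "B = Max (snd ` Poly_Mapping.keys f)"
  define S where "S = {k. (a, k) \<in> Poly_Mapping.keys f}"
  have fin: "finite S"
    by (rule finite_subset[of _ "snd ` Poly_Mapping.keys f"]) (force simp: S_def)+
  have "a \<in> fst ` Poly_Mapping.keys f" unfolding a_def using ne by (intro Max_in) auto
  then have "S \<noteq> {}" by (auto simp: S_def)
  with fin have b: "Max S \<in> S" by (rule Max_in)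
  have sub: "Poly_Mapping.keys f \<subseteq> {..a} \<times> {..B}"
  proof
    fix z assume "z \<in> Poly_Mapping.keys f"
    then have "fst z \<le> a" "snd z \<le> B" unfolding a_def B_def by (auto intro!: Max_ge)
    then show "z \<in> {..a} \<times> {..B}" by (simp add: mem_Times_iff)
  qed
  show ?thesis
  proof (rule that[OF sub])
    show "Max S \<le> B" using b sub by (auto simp: S_def)
    show "Poly_Mapping.lookup f (a, Max S) \<noteq> 0" using b by (simp add: S_def in_keys_iff)
    show "Poly_Mapping.lookup f (a, k) = 0" if "k > Max S" for k
      using Max_ge[OF fin, of k] that by (auto simp: S_def in_keys_iff)
  qed
qed

text \<open>The mode of \<open>elt u p j\<close> at the top index for \<open>a\<close> annihilates
  every monomial whose first exponent is below \<open>a\<close>. On the others it multiplies the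
  coefficient by \<open>u\<close> from the left and replaces the exponent \<open>a\<close> by
  \<open>p\<close>.\<close>

lemma ideal_left_factor:
  assumes i: "i < 2" and I: "conformal_ideal mscale (flip_fixed i) partial (Yplus i) I" and f: "f \<in> I"
    and keys: "Poly_Mapping.keys f \<subseteq> {..a} \<times> {..B}"
  shows "symm i (\<Sum>k\<le>B. elt (u ** Poly_Mapping.lookup f (a, k)) p k) \<in> I"
proof -
  have sub: "ms.subspace I" and IR: "I \<subseteq> flip_fixed i"
    and cl: "\<And>u v n. u \<in> flip_fixed i \<Longrightarrow> v \<in> I \<Longrightarrow> mode (Yplus i) u n v \<in> I"
    using I by (auto simp: conformal_ideal_def)
  \<comment> \<open>So large that \<open>n\<close> exceeds the top index of the second sum for every
    \<open>k\<close> up to \<open>B\<close>.\<close>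
  define j where "j = p + B + 1"
  define n where "n = j + a + pole_shift i"
  define C :: 'a where "C = mode_coeff i p j a n"
  let ?G = "\<Sum>k\<le>B. elt (u ** Poly_Mapping.lookup f (a, k)) p k"
  have C: "C \<noteq> 0" unfolding C_def n_def by (rule mode_coeff_top_neq_0)
  have "mode (Yplus i) (elt u p j) n f
    = (\<Sum>c\<le>a. \<Sum>k\<le>B. mode (Yplus i) (elt u p j) n (elt (Poly_Mapping.lookup f (c, k)) c k))"
    by (subst (1) matpoly_expand_box[OF keys]) (simp only: mode_sum_right)
  also have "\<dots> = (\<Sum>c\<le>a. if c = a then mscale C ?G else 0)"
  proof (rule sum.cong)
    fix c assume "c \<in> {..a}"
    have 2: "mode_coeff i j p k n = (0 :: 'a)" if "k \<le> B" for k
      using that by (intro mode_coeff_eq_0) (simp add: n_def j_def)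
    show "(\<Sum>k\<le>B. mode (Yplus i) (elt u p j) n (elt (Poly_Mapping.lookup f (c, k)) c k))
        = (if c = a then mscale C ?G else 0)"
    proof (cases "c = a")
      case True
      then show ?thesis
        by (simp add: mode_elt[OF i] 2 ms.scale_sum_right) (simp add: C_def n_def)
    next
      case False
      then have "mode_coeff i p j c n = (0 :: 'a)"
        using \<open>c \<in> {..a}\<close> by (intro mode_coeff_eq_0) (simp add: n_def)
      then show ?thesis using False by (simp add: mode_elt[OF i] 2)
    qed
  qed simp
  also have "\<dots> = mscale C ?G" by simp
  finally have "mode (Yplus i) (symm i (elt u p j)) n f = mscale C (symm i ?G)"
    by (simp only: symm_mode_left[OF i subsetD[OF IR f]] symm_mscale)
  with cl[OF symm_in_flip_fixed f, of "elt u p j" n] have "mscale C (symm i ?G) \<in> I" by simp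
  then have "mscale (1 / C) (mscale C (symm i ?G)) \<in> I"
    using sub by (rule ms.subspace_scale[rotated])
  then show ?thesis using C by simp
qed

text \<open>Now the second sum is used, at the top index for \<open>b\<close>, to multiply by
  \<open>u'\<close> from the right. What the first sum contributes has the shape of
  \<open>ideal_left_factor\<close>, hence lies in the ideal and can be subtracted.\<close>

lemma ideal_sandwich:
  assumes i: "i < 2" and I: "conformal_ideal mscale (flip_fixed i) partial (Yplus i) I" and f: "f \<in> I"
    and keys: "Poly_Mapping.keys f \<subseteq> {..a} \<times> {..B}" and b: "b \<le> B"
    and top: "\<And>k. k > b \<Longrightarrow> Poly_Mapping.lookup f (a, k) = 0"
  shows "symm i (elt (u ** Poly_Mapping.lookup f (a, b) ** u') p q) \<in> I"
proof -
  have sub: "ms.subspace I"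
    and cl: "\<And>u v n. u \<in> flip_fixed i \<Longrightarrow> v \<in> I \<Longrightarrow> mode (Yplus i) u n v \<in> I"
    using I by (auto simp: conformal_ideal_def)
  define w where "w k = Poly_Mapping.lookup f (a, k)" for k
  define G where "G u p = (\<Sum>k\<le>B. elt (u ** w k) p k)" for u p
  have G: "symm i (G u p) \<in> I" for u p
    unfolding G_def w_def using ideal_left_factor[OF i I f keys] .
  define j where "j = q + B + 1"
  define n where "n = j + b + pole_shift i"
  define C :: 'a where "C = flip_sign i * mode_coeff i q j b n"
  have C: "C \<noteq> 0" unfolding C_def n_def using mode_coeff_top_neq_0[of i q j b]
    by (auto simp: flip_sign_def)
  have mode_G: "mode (Yplus i) (elt x m1 m2) n (G u p)
    = mscale (mode_coeff i m1 m2 p n) (G (x ** u) (m1 + m2 + p + pole_shift i - n))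
      + (\<Sum>k\<le>B. mscale (flip_sign i * mode_coeff i m2 m1 k n) (elt (u ** w k ** x) p (m1 + m2 + k
        + pole_shift i - n)))" for x m1 m2
    by (simp add: G_def mode_sum_right mode_elt[OF i] sum.distrib ms.scale_sum_right matrix_mul_assoc)
  have "(\<Sum>k\<le>B. mscale (flip_sign i * mode_coeff i q j k n) (elt (u ** w k ** u') p (j + q + k
    + pole_shift i - n)))
    = (\<Sum>k\<le>B. if k = b then mscale C (elt (u ** w b ** u') p q) else 0)"
  proof (rule sum.cong)
    fix k assume "k \<in> {..B}"
    have "j + q + b + pole_shift i - n = q" by (simp add: n_def)
    moreover have "mode_coeff i q j k n = (0 :: 'a)" if "k < b"
      using that by (intro mode_coeff_eq_0) (simp add: n_def)
    moreover have "w k = 0" if "k > b" using top that by (simp add: w_def)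
    ultimately show "mscale (flip_sign i * mode_coeff i q j k n) (elt (u ** w k ** u') p (j + q + k
      + pole_shift i - n))
      = (if k = b then mscale C (elt (u ** w b ** u') p q) else 0)"
      by (cases k b rule: linorder_cases) (auto simp: C_def matrix_zero_left matrix_zero_right)
  qed simp
  also have "\<dots> = mscale C (elt (u ** w b ** u') p q)" using b by simp
  finally have 1: "mode (Yplus i) (elt u' j q) n (G u p)
      = mscale (mode_coeff i j q p n) (G (u' ** u) (j + q + p + pole_shift i - n))
        + mscale C (elt (u ** w b ** u') p q)"
    unfolding mode_G by simp
  \<comment> \<open>The flipped half of the symmetrized operator contributes only through its first
    sum, by the choice of \<open>j\<close>.\<close>
  have "mode_coeff i j q k n = (0 :: 'a)" if "k \<le> B" for k
    using that by (intro mode_coeff_eq_0) (simp add: n_def j_def)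
  then have 2: "mode (Yplus i) (elt x q j) n (G u p)
    = mscale (mode_coeff i q j p n) (G (x ** u) (q + j + p + pole_shift i - n))" for x
    unfolding mode_G by simp
  let ?t = "mat_scale (flip_sign i) (transpose u')"
  have "mode (Yplus i) (symm i (elt u' j q)) n (symm i (G u p))
    = symm i (mode (Yplus i) (symm i (elt u' j q)) n (G u p))"
    by (rule symm_mode_right[OF i]) simp
  also have "mode (Yplus i) (symm i (elt u' j q)) n (G u p)
    = mode (Yplus i) (elt u' j q) n (G u p) + mode (Yplus i) (elt ?t q j) n (G u p)"
    by (simp add: symm_def flip_elt mode_add_left)
  also have "symm i \<dots> = mscale (mode_coeff i j q p n) (symm i (G (u' ** u) (j + q + p + pole_shift i
    - n)))
      + mscale C (symm i (elt (u ** w b ** u') p q))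
      + mscale (mode_coeff i q j p n) (symm i (G (?t ** u) (q + j + p + pole_shift i - n)))"
    unfolding 1 2 by (simp only: symm_add symm_mscale)
  finally have eq: "mscale C (symm i (elt (u ** w b ** u') p q))
    = mode (Yplus i) (symm i (elt u' j q)) n (symm i (G u p))
      - mscale (mode_coeff i j q p n) (symm i (G (u' ** u) (j + q + p + pole_shift i - n)))
      - mscale (mode_coeff i q j p n) (symm i (G (?t ** u) (q + j + p + pole_shift i - n)))"
    by (simp add: algebra_simps)
  have "mscale C (symm i (elt (u ** w b ** u') p q)) \<in> I"
    unfolding eq by (intro ms.subspace_diff ms.subspace_scale sub G cl symm_in_flip_fixed)
  then have "mscale (1 / C) (mscale C (symm i (elt (u ** w b ** u') p q))) \<in> I"
    using sub by (rule ms.subspace_scale[rotated])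
  then show ?thesis using C by (simp add: w_def)
qed

lemma conformal_simple_flip_fixed:
  assumes i: "i < 2"
  shows "conformal_simple mscale (flip_fixed i) partial (Yplus i ::
    ('f::field_char_0, 'n::finite) matpoly \<Rightarrow> _)"
proof -
  have "I = flip_fixed i" if I: "conformal_ideal mscale (flip_fixed i) partial (Yplus i) I"
    and ne: "I \<noteq> {0}"
    for I :: "('f, 'n) matpoly set"
  proof
    have sub: "ms.subspace I" and "I \<subseteq> flip_fixed i" using I by (auto simp: conformal_ideal_def)
    show "I \<subseteq> flip_fixed i" by fact
    obtain f where f: "f \<in> I" "f \<noteq> 0"
      using ne ms.subspace_0[OF sub] by blast
    obtain a B b where ab: "Poly_Mapping.keys f \<subseteq> {..a} \<times> {..B}" "b \<le> B"
        "Poly_Mapping.lookup f (a, b) \<noteq> 0" "\<And>k. k > b \<Longrightarrow> Poly_Mapping.lookup f (a, k) = 0"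
      by (rule leading_key[OF f(2)], rule that)
    obtain r s where c: "Poly_Mapping.lookup f (a, b) $ r $ s \<noteq> 0"
      using ab(3) unfolding vec_eq_iff zero_index by blast
    let ?c = "Poly_Mapping.lookup f (a, b) $ r $ s"
    have "symm i (elt (matunit p q) m n) \<in> I" for p q m n
    proof -
      have "mscale ?c (symm i (elt (matunit p q) m n)) \<in> I"
        using ideal_sandwich[OF i I f(1) ab(1,2,4), of "matunit p r" "matunit s q" m n]
        by (simp add: matunit_sandwich elt_mat_scale symm_mscale)
      then have "mscale (1 / ?c) (mscale ?c (symm i (elt (matunit p q) m n))) \<in> I"
        using sub by (rule ms.subspace_scale[rotated])
      then show ?thesis using c by simp
    qed
    then show "flip_fixed i \<subseteq> I"
      unfolding flip_fixed_eq_span by (intro ms.span_minimal sub) auto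
  qed
  moreover have "conformal_ideal mscale (flip_fixed i) partial (Yplus i) (flip_fixed i ::
    ('f, 'n) matpoly set)"
    using subspace_flip_fixed flip_fixed_closed[OF i] by (auto simp: conformal_ideal_def)
  moreover have "conformal_ideal mscale (flip_fixed i) partial (Yplus i) {0 :: ('f, 'n) matpoly}"
    using ms.subspace_0[OF subspace_flip_fixed] by (auto simp: conformal_ideal_def partial_0)
  ultimately have "conformal_ideal mscale (flip_fixed i) partial (Yplus i) I \<longleftrightarrow> I \<in> {{0}, flip_fixed i}"
    for I :: "('f, 'n) matpoly set"
    by auto
  then show ?thesis
    unfolding conformal_simple_def by (intro set_eqI) (simp only: mem_Collect_eq)
qed

section \<open>Generation\<close>

text \<open>Let \<open>W\<close> be the span of the words. The elements whose modes all preserve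
  \<open>W\<close> include \<open>S\<close> and, by the Jacobi identity, are closed under modes, so
  they include every word. Thus \<open>W\<close> is closed under the modes of its own
  elements.\<close>

lemma generated_byI:
  fixes S :: "('f::field_char_0, 'n::finite) matpoly set"
  assumes i: "i < 2" and S: "S \<subseteq> flip_fixed i"
    and W: "\<And>W. \<lbrakk>ms.subspace W; W \<subseteq> flip_fixed i; S \<subseteq> W; \<And>u w n. \<lbrakk>u \<in> W; w \<in> W\<rbrakk> \<Longrightarrow> mode
      (Yplus i) u n w \<in> W\<rbrakk>
      \<Longrightarrow> flip_fixed i \<subseteq> W"
  shows "generated_by mscale (flip_fixed i) (Yplus i) S"
proof -
  let ?word = "\<lambda>us v. foldr (\<lambda>(u, m) w. mode (Yplus i) u m w) us v"
  let ?B = "{?word us v |us v. fst ` set us \<subseteq> S \<and> v \<in> S}"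
  define W where "W = ms.span ?B"
  have sub: "ms.subspace W" by (simp add: W_def ms.subspace_span)
  have word_flip_fixed: "?word us v \<in> flip_fixed i" if "fst ` set us \<subseteq> S" "v \<in> S" for us v
    using that by (induction us) (use S in \<open>auto intro!: flip_fixed_closed[OF i]\<close>)
  then have WR: "W \<subseteq> flip_fixed i"
    unfolding W_def by (intro ms.span_minimal subspace_flip_fixed) auto
  have SW: "S \<subseteq> W"
  proof
    fix v assume "v \<in> S"
    then have "?word [] v \<in> ?B" by (intro CollectI exI[of _ "[]"] exI[of _ v]) auto
    then show "v \<in> W" unfolding W_def by (intro ms.span_base) simp
  qed
  have act_S: "mode (Yplus i) u n w \<in> W" if "u \<in> S" "w \<in> W" for u n w
  proof -
    have "W \<subseteq> {w. mode (Yplus i) u n w \<in> W}"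
      unfolding W_def
    proof (rule ms.span_minimal)
      show "?B \<subseteq> {w. mode (Yplus i) u n w \<in> ms.span ?B}"
      proof clarify
        fix us :: "(('f, 'n) matpoly \<times> nat) list" and v assume *: "fst ` set us \<subseteq> S" "v \<in> S"
        have "?word ((u, n) # us) v \<in> ms.span ?B"
          by (intro ms.span_base CollectI exI[of _ "(u, n) # us"] exI[of _ v] conjI)
            (use * that(1) in auto)
        then show "mode (Yplus i) u n (?word us v) \<in> ms.span ?B" by simp
      qed
      show "ms.subspace {w. mode (Yplus i) u n w \<in> ms.span ?B}"
        by (auto simp: ms.subspace_def mode_add_right mode_mscale_right[OF i] ms.span_zero ms.span_add
          ms.span_scale)
    qed
    then show ?thesis using that by blast
  qed
  define Act where "Act = {u. \<forall>n. \<forall>w\<in>W. mode (Yplus i) u n w \<in> W}"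
  have "ms.subspace Act"
    using sub unfolding ms.subspace_def Act_def by (auto simp: mode_add_left mode_mscale_left[OF i])
  moreover have "mode (Yplus i) u p v \<in> Act" if u: "u \<in> Act" and v: "v \<in> Act" for u v p
  proof (induction p rule: less_induct)
    case (less p)
    have "mode (Yplus i) (mode (Yplus i) u p v) n w \<in> W" if w: "w \<in> W" for n w
    proof -
      \<comment> \<open>The last term of the Jacobi sum is the wanted mode; the earlier ones involve
        modes of \<open>u\<close> on \<open>v\<close> of index below \<open>p\<close>, covered by
        induction.\<close>
      have "mode (Yplus i) u p (mode (Yplus i) v n w) - mode (Yplus i) v n (mode (Yplus i) u p w)
        = (\<Sum>q<p. mscale (of_nat (p choose q)) (mode (Yplus i) (mode (Yplus i) u q v) (p + n - q) w))
          + mode (Yplus i) (mode (Yplus i) u p v) n w"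
        unfolding mode_jacobi[OF i] by (simp flip: lessThan_Suc_atMost)
      then have eq: "mode (Yplus i) (mode (Yplus i) u p v) n w
        = mode (Yplus i) u p (mode (Yplus i) v n w) - mode (Yplus i) v n (mode (Yplus i) u p w)
          - (\<Sum>q<p. mscale (of_nat (p choose q)) (mode (Yplus i) (mode (Yplus i) u q v) (p + n - q) w))"
        by (simp add: algebra_simps)
      show ?thesis
        unfolding eq using u v w less.IH
        by (intro ms.subspace_diff ms.subspace_sum ms.subspace_scale sub) (auto simp: Act_def)
    qed
    then show ?case by (simp add: Act_def)
  qed
  moreover have "S \<subseteq> Act" using act_S by (auto simp: Act_def)
  ultimately have "?word us v \<in> Act" if "fst ` set us \<subseteq> S" "v \<in> S" for us v
    using that by (induction us) auto
  then have "W \<subseteq> Act"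
    unfolding W_def by (intro ms.span_minimal \<open>ms.subspace Act\<close>) auto
  then have "flip_fixed i \<subseteq> W"
    by (intro W sub WR SW) (auto simp: Act_def)
  with WR show ?thesis by (simp add: generated_by_def W_def)
qed

section \<open>Modes of the weight 2 generators and reduction modulo the derivation\<close>

lemma mode_symm_elt:
  assumes "i < 2"
  shows "mode (Yplus i) (symm j (elt u m1 m2)) n f
    = mode (Yplus i) (elt u m1 m2) n f + mscale (flip_sign j) (mode (Yplus i) (elt
      (transpose u) m2 m1) n f)"
  by (simp add: symm_def flip_elt mode_add_left elt_mat_scale mode_mscale_left[OF assms])

lemma matpoly_eqI:
  assumes "\<And>m n p q. Poly_Mapping.lookup f (m, n) $ p $ q = Poly_Mapping.lookup g (m, n) $ p $ q"
  shows "f = g"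
  by (rule poly_mapping_eqI) (auto simp: vec_eq_iff assms)

lemmas lookup_simps = lookup_add lookup_minus lookup_mscale lookup_elt

text \<open>The exponent \<open>i\<close> gives \<open>elt u i 0\<close> weight 2 in either copy. At
  \<open>l = 0\<close> the bracket with this symmetrized identity is multiplication by
  \<open>2 * (x + y)\<close>.\<close>

lemma conformal_element:
  assumes i: "i < 2"
  shows "mode (Yplus i) (symm i (elt (mat 1) i 0)) 0 f = mscale 2 (partial f)"
proof (induction f rule: matpoly_induct)
  case (elt v n1 n2)
  show ?case
    by (rule matpoly_eqI, simp only: mode_symm_elt[OF i] mode_elt[OF i] partial_elt lookup_simps,
      use less_2_cases[OF i] in \<open>elim disjE; simp add: mode_coeff_def pole_shift_def flip_sign_def
        mat_scale_def transpose_mat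
        lookup_simps matrix_add_rdistrib matrix_add_ldistrib algebra_simps\<close>)
qed (simp add: mode_add_right partial_add ms.scale_right_distrib)

text \<open>Applying \<open>partial\<close> to an element of degree \<open>d\<close> relates the
  neighbours \<open>(m + 1, n)\<close> and \<open>(m, n + 1)\<close> modulo \<open>W\<close>;
  iterating the ratio produces the signed binomial.\<close>

lemma symm_reduce:
  assumes sub: "ms.subspace W" and D: "\<And>w. w \<in> W \<Longrightarrow> partial w \<in> W"
    and low: "\<And>m n. m + n = d \<Longrightarrow> symm i (elt u m n) \<in> W"
    and mn: "m + n = Suc d"
  shows "symm i (elt u m n) - mscale ((- 1) ^ n * of_nat (Suc d choose n)) (symm i (elt u
    (Suc d) 0)) \<in> W"
  using mn
proof (induction n arbitrary: m)
  case 0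
  then show ?case using ms.subspace_0[OF sub] by simp
next
  case (Suc n)
  let ?X = "\<lambda>m n. symm i (elt u m n)"
  let ?r = "\<lambda>n. (- 1) ^ n * of_nat (Suc d choose n) :: 'a"
  have a: "?X (Suc m) n - mscale (?r n) (?X (Suc d) 0) \<in> W"
    by (rule Suc.IH) (use Suc.prems in simp)
  have b: "partial (?X m n) \<in> W"
    by (intro D low) (use Suc.prems in simp)
  have "partial (?X m n) = mscale (of_nat (Suc m)) (?X (Suc m) n)
    + mscale (of_nat (Suc n)) (?X m (Suc n))"
    by (simp only: symm_def partial_add flip_partial[symmetric] partial_elt flip_add flip_mscale
        ms.scale_right_distrib) (simp add: add_ac)
  then have X: "mscale (of_nat (Suc n)) (?X m (Suc n))
    = partial (?X m n) - mscale (of_nat (Suc m)) (?X (Suc m) n)"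
    by simp
  have "of_nat (Suc n) * of_nat (Suc d choose Suc n) = (of_nat (Suc m) * of_nat (Suc d choose n) :: 'a)"
  proof -
    have "Suc n * (Suc d choose Suc n) = Suc m * (Suc d choose n)"
      using Suc.prems binomial_absorb_comp[of "Suc d" n] binomial_absorption[of n "Suc d"]
      by (simp del: binomial_Suc_Suc mult_Suc add: Suc_diff_le flip: Suc.prems)
    then show ?thesis by (metis of_nat_mult)
  qed
  then have r: "of_nat (Suc n) * ?r (Suc n) = - (of_nat (Suc m) * ?r n)"
    by (simp add: mult.left_commute del: of_nat_Suc)
  have "mscale (of_nat (Suc n)) (?X m (Suc n) - mscale (?r (Suc n)) (?X (Suc d) 0))
    = partial (?X m n) - mscale (of_nat (Suc m)) (?X (Suc m) n - mscale (?r n) (?X (Suc d) 0))"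
    unfolding ms.scale_right_diff_distrib X ms.scale_scale r by (simp del: of_nat_Suc binomial_Suc_Suc)
  also have "\<dots> \<in> W"
    by (intro ms.subspace_diff ms.subspace_scale sub a b)
  finally have "mscale (1 / of_nat (Suc n)) (mscale (of_nat (Suc n)) (?X m (Suc n)
    - mscale (?r (Suc n)) (?X (Suc d) 0))) \<in> W"
    using sub by (rule ms.subspace_scale[rotated])
  then show ?case by (simp only: ms.scale_scale) (simp del: of_nat_Suc binomial_Suc_Suc power_Suc)
qed

lemma symm_reduce_in:
  assumes sub: "ms.subspace W" and D: "\<And>w. w \<in> W \<Longrightarrow> partial w \<in> W"
    and low: "\<And>m n. m + n = d \<Longrightarrow> symm i (elt u m n) \<in> W"
    and top: "symm i (elt u (Suc d) 0) \<in> W"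
    and mn: "m + n = Suc d"
  shows "symm i (elt u m n) \<in> W"
proof -
  have "symm i (elt u m n) - mscale ((- 1) ^ n * of_nat (Suc d choose n)) (symm i (elt u (Suc d) 0))
      + mscale ((- 1) ^ n * of_nat (Suc d choose n)) (symm i (elt u (Suc d) 0)) \<in> W"
    by (intro ms.subspace_add ms.subspace_scale sub top symm_reduce[OF sub D low mn])
  then show ?thesis by simp
qed

lemma subspace_scale_cancel:
  assumes "ms.subspace W" "mscale c x \<in> W" "c \<noteq> 0"
  shows "x \<in> W"
  using ms.subspace_scale[OF assms(1,2), of "1 / c"] assms(3) by simp

text \<open>On these monomials the mode of index 0 raises the total degree by one, that of index 1
  keeps it, and that of index 2 lowers it.\<close>

lemma mode_0_weight2:
  assumes i: "i < 2"
  shows "mode (Yplus i) (symm i (elt e i 0)) 0 (elt v n 0)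
    = mscale (of_nat (Suc n)) (elt ((e + transpose e) ** v) (Suc n) 0) + elt (v ** (e
      + transpose e)) n 1"
  by (rule matpoly_eqI, simp only: mode_symm_elt[OF i] mode_elt[OF i]  lookup_simps,
      use less_2_cases[OF i] in \<open>elim disjE; simp add: mode_coeff_def pole_shift_def flip_sign_def
        mat_scale_def
        lookup_simps matrix_add_rdistrib matrix_add_ldistrib algebra_simps\<close>)

lemma mode_1_weight2:
  assumes i: "i < 2"
  shows "mode (Yplus i) (symm i (elt e i 0)) 1 (elt v n 0)
    = elt (mat_scale (of_nat (Suc n)) (transpose e ** v) + v ** e
       + (if i = 0 then mat_scale (of_nat (Suc n)) (e ** v)
         + v ** transpose e else mat_scale (of_nat n) (e ** v))) n 0"
  by (rule matpoly_eqI, simp only: mode_symm_elt[OF i] mode_elt[OF i]  lookup_simps,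
      use less_2_cases[OF i] in \<open>elim disjE; simp add: mode_coeff_def pole_shift_def flip_sign_def
        mat_scale_def
        lookup_simps matrix_add_rdistrib matrix_add_ldistrib algebra_simps\<close>)

lemma mode_2_weight2:
  "mode (Yplus 1) (symm 1 (elt e 1 0)) 2 (elt v 1 0) = mscale 2 (elt (transpose e ** v) 0 0)"
  by (rule matpoly_eqI) (simp add: mode_symm_elt mode_elt mode_coeff_def pole_shift_def flip_sign_def
    lookup_simps numeral_2_eq_2)

text \<open>Induction on the degree. By \<open>symm_reduce_in\<close> only \<open>(Suc d, 0)\<close>
  matters: modes of index 0 raise the off-diagonal matrix units from degree \<open>d\<close>, and
  modes of index 1 turn them into diagonal ones.\<close>

lemma flip_fixed_subset_if_card_gt_1:
  fixes W :: "('f::field_char_0, 'n::finite) matpoly set"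
  assumes i: "i < 2" and card: "CARD('n) > 1"
    and sub: "ms.subspace W" and S: "\<And>e. symm i (elt e i 0) \<in> W"
    and cl: "\<And>u w n. \<lbrakk>u \<in> W; w \<in> W\<rbrakk> \<Longrightarrow> mode (Yplus i) u n w \<in> W"
  shows "flip_fixed i \<subseteq> W"
proof -
  have D: "partial w \<in> W" if "w \<in> W" for w
    using cl[OF S[of "mat 1"] that, of 0] unfolding conformal_element[OF i]
    by (rule subspace_scale_cancel[OF sub]) simp
  have act: "symm i (mode (Yplus i) (symm i (elt e i 0)) n v) \<in> W" if "symm i v \<in> W" for e n v
    using cl[OF S that, of e n] by (simp add: symm_mode_right[OF i])
  have other: "\<exists>p. p \<noteq> q" for q :: 'n
  proof (rule ccontr)
    assume "\<nexists>p. p \<noteq> q"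
    then have "(UNIV :: 'n set) = {q}" by auto
    then have "CARD('n) = 1" by (metis card_1_singleton_iff One_nat_def)
    with card show False by simp
  qed
  have "symm i (elt (matunit p q) m n) \<in> W" if "m + n = d" for p q :: 'n and m n d
    using that
  proof (induction d arbitrary: p q m n)
    case 0
    then have mn: "m = 0" "n = 0" by auto
    show ?case
    proof (cases "i = 0")
      case True
      then show ?thesis using S mn by simp
    next
      case False
      with i have i1: "i = 1" by simp
      have "mscale 2 (symm i (elt (matunit p q) 0 0)) \<in> W"
        \<comment> \<open>In copy 1 the weight 2 elements have degree 1, so degree 0 is reached by
          lowering.\<close>
        using act[OF S[of "matunit p q"], where e = "matunit p p" and n = 2]
        by (simp add: i1 mode_2_weight2[simplified] matunit_mult symm_mscale)
      then show ?thesis unfolding mn by (rule subspace_scale_cancel[OF sub]) simp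
    qed
  next
    case (Suc d)
    have off: "symm i (elt (matunit r s) (Suc d) 0) \<in> W" if "r \<noteq> s" for r s
    proof -
      have two: "matunit r s + matunit r s = mat_scale 2 (matunit r s :: 'f^'n^'n)"
        using sm.scale_left_distrib[of 1 1 "matunit r s :: 'f^'n^'n"]
          by (simp only: one_add_one sm.scale_one)
      have "mode (Yplus i) (symm i (elt (matunit r r) i 0)) 0 (elt (matunit r s) d 0)
        = mscale (2 * of_nat (Suc d)) (elt (matunit r s :: 'f^'n^'n) (Suc d) 0)"
        using that by (simp only: mode_0_weight2[OF i] matrix_add_rdistrib matrix_add_ldistrib
            transpose_matunit matunit_mult two elt_mat_scale if_True simp_thms)
              (simp add: mult_ac del: of_nat_Suc)
      then have "mscale (2 * of_nat (Suc d)) (symm i (elt (matunit r s) (Suc d) 0)) \<in> W"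
        using act[where v = "elt (matunit r s) d 0" and e = "matunit r r" and n = 0] Suc.IH[of d 0 r s]
          by (simp add: symm_mscale del: of_nat_Suc)
      then show ?thesis by (rule subspace_scale_cancel[OF sub]) (simp del: of_nat_Suc)
    qed
    have top: "symm i (elt (matunit p q) (Suc d) 0) \<in> W"
    proof (cases "p = q")
      case False
      then show ?thesis by (rule off)
    next
      case True
      define c :: 'f where "c = of_nat (Suc (Suc d))"
      have c: "c \<noteq> 0" "c * c - 1 \<noteq> 0"
      proof -
        show "c \<noteq> 0" by (simp add: c_def del: of_nat_Suc)
        have "c * c - 1 = of_nat ((Suc d) * (Suc d + 2))" by (simp add: c_def algebra_simps)
        then show "c * c - 1 \<noteq> 0" by (simp only: of_nat_eq_0_iff) simp
      qed
      obtain r where r: "r \<noteq> q" using other by blast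
      show ?thesis
      proof (cases "i = 0")
        case False
        have "mode (Yplus i) (symm i (elt (matunit r q) i 0)) 1 (elt (matunit r q) (Suc d) 0)
          = mscale c (elt (matunit q q :: 'f^'n^'n) (Suc d) 0)"
          using False r by (simp only: mode_1_weight2[OF i])
            (simp add: matunit_mult elt_mat_scale c_def del: of_nat_Suc)
        then have "mscale c (symm i (elt (matunit q q) (Suc d) 0)) \<in> W"
          using act[OF off[OF r], where e = "matunit r q" and n = 1] by (simp add: symm_mscale)
        then show ?thesis unfolding True by (rule subspace_scale_cancel[OF sub _ c(1)])
      next
        case i0: True
        have *: "mscale c (symm i (elt (matunit s s) (Suc d) 0))
          + symm i (elt (matunit t t) (Suc d) 0) \<in> W"
          if "t \<noteq> s" for s t
        proof -
          have "mode (Yplus i) (symm i (elt (matunit t s) i 0)) 1 (elt (matunit t s) (Suc d) 0)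
            = mscale c (elt (matunit s s :: 'f^'n^'n) (Suc d) 0) + elt (matunit t t) (Suc d) 0"
            by (simp only: mode_1_weight2[OF i] if_P[OF i0] transpose_matunit matunit_mult that
                that[symmetric] simp_thms if_True if_False sm.scale_zero_right add_0_left add_0_right
                elt_add elt_mat_scale c_def)
          then show ?thesis
            using act[OF off[OF that], where e = "matunit t s" and n = 1]
              by (simp add: symm_mscale symm_add)
        qed
        \<comment> \<open>The relation \<open>*\<close> for \<open>(q, r)\<close> and for
          \<open>(r, q)\<close> is a linear system with determinant \<open>c * c - 1\<close>; this
          combination eliminates \<open>matunit r r\<close>.\<close>
        have "mscale c (mscale c (symm i (elt (matunit q q) (Suc d) 0))
          + symm i (elt (matunit r r) (Suc d) 0))
          - (mscale c (symm i (elt (matunit r r) (Suc d) 0))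
            + symm i (elt (matunit q q) (Suc d) 0)) \<in> W"
          by (intro ms.subspace_diff ms.subspace_scale sub * r r[symmetric])
        also have "mscale c (mscale c (symm i (elt (matunit q q) (Suc d) 0))
          + symm i (elt (matunit r r) (Suc d) 0))
          - (mscale c (symm i (elt (matunit r r) (Suc d) 0)) + symm i (elt (matunit q q) (Suc d) 0))
          = mscale (c * c - 1) (symm i (elt (matunit q q) (Suc d) 0))"
          by (simp add: ms.scale_right_distrib ms.scale_left_diff_distrib)
        finally show ?thesis unfolding True by (rule subspace_scale_cancel[OF sub _ c(2)])
      qed
    qed
    show ?case
      by (rule symm_reduce_in[OF sub D Suc.IH top Suc.prems])
  qed
  then show ?thesis
    unfolding flip_fixed_eq_span by (intro ms.span_minimal sub) auto
qed

text \<open>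
  For \<open>k = 1\<close> the reduction modulo \<open>\<partial>\<close> kills the elements of the wrong parity, and the mode of index 1
  of the second generator raises the degree by 2.
\<close>

lemma flip_fixed_subset_if_card_1:
  fixes W :: "('f::field_char_0, 'n::finite) matpoly set"
  assumes i: "i < 2" and card: "CARD('n) = 1"
    and sub: "ms.subspace W" and S: "symm i (elt (mat 1) i 0) \<in> W"
    and cl: "\<And>u w n. \<lbrakk>u \<in> W; w \<in> W\<rbrakk> \<Longrightarrow> mode (Yplus i) u n w \<in> W"
    and c: "c \<in> W" "c \<in> flip_fixed i" and g: "g \<noteq> 0"
    and mode_c: "\<And>n. \<exists>a b. mode (Yplus i) c 1 (elt (mat 1) n 0)
        = mscale (of_nat a * g) (elt (mat 1) (n + 2) 0) + mscale (of_nat (Suc b) * g) (elt (mat 1) n 2)"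
  shows "flip_fixed i \<subseteq> W"
proof -
  let ?X = "\<lambda>m n. symm i (elt (mat 1) m n) :: ('f, 'n) matpoly"
  have D: "partial w \<in> W" if "w \<in> W" for w
    using cl[OF S that, of 0] unfolding conformal_element[OF i]
    by (rule subspace_scale_cancel[OF sub]) simp
  have swap: "?X 0 n = mscale (flip_sign i) (?X n 0)" for n
    using symm_flip[of i "elt (mat 1) 0 n"]
    by (simp only: flip_elt transpose_mat elt_mat_scale symm_mscale eq_commute)
  have "?X m n \<in> W" if "m + n = d" for m n d
    using that
  proof (induction d arbitrary: m n rule: less_induct)
    case (less d)
    show ?case
    proof (cases d)
      case 0
      then have "m = 0" "n = 0" using less.prems by auto
      moreover have "?X 0 0 \<in> W"
      proof (cases "i = 0")
        case False
        then have "?X 0 0 = 0" by (simp add: symm_def flip_elt transpose_mat flip_sign_def elt_uminus)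
        then show ?thesis using ms.subspace_0[OF sub] by simp
      qed (use S in simp)
      ultimately show ?thesis by simp
    next
      case (Suc d')
      have low: "?X m n \<in> W" if "m + n = d'" for m n
        using less.IH[of d'] that Suc by simp
      have reduce: "?X m n - mscale ((- 1) ^ n * of_nat (Suc d' choose n)) (?X (Suc d') 0) \<in> W"
        if "m + n = Suc d'" for m n
        by (rule symm_reduce[OF sub D _ that]) (simp_all add: low)
      have top: "?X (Suc d') 0 \<in> W"
      \<comment> \<open>Symmetry makes \<open>?X 0 (Suc d')\<close> the multiple of
        \<open>?X (Suc d') 0\<close> by \<open>flip_sign i\<close>, and reduction makes it, modulo
        \<open>W\<close>, the multiple by \<open>(- 1) ^ Suc d'\<close>. If the signs differ,
        \<open>?X (Suc d') 0\<close> lies in \<open>W\<close>.\<close>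
      proof (cases "flip_sign i = ((- 1) ^ Suc d' :: 'f)")
        case False
        have "mscale (flip_sign i - (- 1) ^ Suc d') (?X (Suc d') 0) \<in> W"
          using reduce[of 0 "Suc d'"] by (simp add: swap ms.scale_left_diff_distrib del: power_Suc)
        then show ?thesis by (rule subspace_scale_cancel[OF sub])
          (use False in \<open>simp only: right_minus_eq simp_thms\<close>)
      next
        case par: True
        show ?thesis
        proof (cases d')
          case 0
          with par have "i \<noteq> 0" by (auto simp: flip_sign_def split: if_splits)
          with i have "i = 1" by simp
          then show ?thesis using S 0 by simp
        next
          case (Suc n)
          obtain a b where ab: "mode (Yplus i) c 1 (elt (mat 1) n 0)
            = mscale (of_nat a * g) (elt (mat 1) (n + 2) 0)
              + mscale (of_nat (Suc b) * g) (elt (mat 1) n 2)"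
            using mode_c by blast
          let ?N = "Suc d' choose 2"
          have "?X n 0 \<in> W" using less.IH[of n n 0] Suc \<open>d = Suc d'\<close> by simp
          then have "mode (Yplus i) c 1 (?X n 0) \<in> W" by (rule cl[OF c(1)])
          then have "symm i (mode (Yplus i) c 1 (elt (mat 1) n 0)) \<in> W"
            by (simp add: symm_mode_right[OF i c(2)])
          then have 1: "mscale (of_nat a * g) (?X (Suc d') 0)
            + mscale (of_nat (Suc b) * g) (?X n 2) \<in> W"
            unfolding ab by (simp add: symm_add symm_mscale Suc del: of_nat_Suc)
          have 2: "?X n 2 - mscale (of_nat ?N) (?X (Suc d') 0) \<in> W"
            using reduce[of n 2] Suc by (simp del: binomial_Suc_Suc)
          have "mscale (of_nat a * g) (?X (Suc d') 0) + mscale (of_nat (Suc b) * g) (?X n 2)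
            - mscale (of_nat (Suc b) * g) (?X n 2 - mscale (of_nat ?N) (?X (Suc d') 0)) \<in> W"
            by (intro ms.subspace_diff ms.subspace_scale sub 1 2)
          then have "mscale (of_nat (a + Suc b * ?N) * g) (?X (Suc d') 0) \<in> W"
            by (simp add: ms.scale_right_diff_distrib ms.scale_left_distrib distrib_left distrib_right
              mult_ac
                del: of_nat_Suc binomial_Suc_Suc mult_Suc)
          \<comment> \<open>Both terms share the factor \<open>g\<close> and have natural
            coefficients, the second positive, so nothing cancels in characteristic 0.\<close>
          moreover have "of_nat (a + Suc b * ?N) * g \<noteq> 0"
          proof -
            have "?N > 0" by (rule zero_less_binomial) (use Suc in simp)
            then have "a + Suc b * ?N \<noteq> 0" by (simp del: binomial_Suc_Suc mult_Suc)
            with g show ?thesis by (simp only: mult_eq_0_iff of_nat_eq_0_iff simp_thms)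
          qed
          ultimately show ?thesis by (rule subspace_scale_cancel[OF sub])
        qed
      qed
      show ?thesis
        by (rule symm_reduce_in[OF sub D low top]) (use less.prems Suc in simp_all)
    qed
  qed
  moreover have "matunit p q = (mat 1 :: 'f^'n^'n)" for p q
  proof -
    obtain z :: 'n where z: "UNIV = {z}" using card by (meson card_1_singletonE)
    have eq: "x = y" for x y :: 'n
      using UNIV_I[of x] UNIV_I[of y] unfolding z by simp
    have "matunit p q $ j $ k = (mat 1 :: 'f^'n^'n) $ j $ k" for j k
    proof -
      have "matunit p q $ j $ k = (1 :: 'f)"
        unfolding matunit_def vec_lambda_beta by (rule if_P) (intro conjI eq)
      moreover have "mat 1 $ j $ k = (1 :: 'f)"
        unfolding mat_def vec_lambda_beta by (rule if_P) (rule eq)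
      ultimately show ?thesis by simp
    qed
    then show ?thesis by (simp add: vec_eq_iff)
  qed
  ultimately show ?thesis
    unfolding flip_fixed_eq_span by (intro ms.span_minimal sub) auto
qed

section \<open>The weight 2 subspace and the generating sets\<close>

lemma symm_elt: "symm i (elt u m n) = elt u m n + mscale (flip_sign i) (elt (transpose u) n m)"
  by (simp add: symm_def flip_elt elt_mat_scale)

lemma symm_in_weight2:
  assumes i: "i < 2"
  shows "symm i (elt e i 0) \<in> weight_space i 2"
  using less_2_cases[OF i] unfolding weight_space_def
  by (auto simp: symm_elt in_keys_iff lookup_add lookup_elt lookup_mscale mat_scale_def[symmetric]
      split: if_splits)

text \<open>Weight 2 leaves only the exponents \<open>(i, 0)\<close> and \<open>(0, i)\<close>, and
  symmetrization does not distinguish a monomial from its flip.\<close>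

lemma weight2_eq_span:
  assumes i: "i < 2"
  shows "flip_fixed i \<inter> weight_space i 2
    = ms.span {symm i (elt (matunit p q :: 'f::field_char_0^'n^'n::finite) i 0) |p q. True}"
    (is "_ = ms.span ?B")
proof
  have mem: "symm i (elt e i 0) \<in> ms.span ?B" for e
  proof -
    have "symm i (elt e i 0) = (\<Sum>p\<in>UNIV. \<Sum>q\<in>UNIV. mscale (e $ p $ q) (symm i (elt (matunit p q) i 0)))"
      by (subst (1) matrix_expand[of e]) (simp only: elt_sum symm_sum elt_mat_scale symm_mscale)
    also have "\<dots> \<in> ms.span ?B"
      by (intro ms.span_sum ms.span_scale ms.span_base) blast
    finally show ?thesis .
  qed
  show "flip_fixed i \<inter> weight_space i 2 \<subseteq> ms.span ?B"
  proof
    fix f :: "('f, 'n) matpoly" assume f: "f \<in> flip_fixed i \<inter> weight_space i 2"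
    have "symm i (elt (Poly_Mapping.lookup f k) (fst k) (snd k)) \<in> ms.span ?B"
      if "k \<in> Poly_Mapping.keys f" for k
    proof -
      have "fst k + snd k = i"
        using f that i by (cases k) (auto simp: weight_space_def split: if_splits)
      then consider "fst k = i" "snd k = 0" | "fst k = 0" "snd k = i"
        using i by linarith
      then show ?thesis
      proof cases
        case 1
        then show ?thesis using mem by simp
      next
        case 2
        have "symm i (elt (Poly_Mapping.lookup f k) 0 i)
          = symm i (elt (mat_scale (flip_sign i) (transpose (Poly_Mapping.lookup f k))) i 0)"
          by (subst symm_flip[symmetric]) (simp add: flip_elt)
        with 2 show ?thesis using mem by simp
      qed
    qed
    then have "mscale (1/2) (symm i f) \<in> ms.span ?B"
      by (subst matpoly_expand[of f]) (simp only: symm_sum, intro ms.span_scale ms.span_sum)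
    then show "f \<in> ms.span ?B"
      using f flip_fixed_eq_symm[of f i] by simp
  qed
  have "ms.subspace (weight_space i 2 :: ('f, 'n) matpoly set)"
  proof -
    have eq: "weight_space i 2 = {f. \<forall>m n. m + n + (if i = 0 then 2 else 1) \<noteq> 2
        \<longrightarrow> Poly_Mapping.lookup f (m, n) = (0 :: 'f^'n^'n)}"
      unfolding weight_space_def Ball_def in_keys_iff split_paired_All prod.case by blast
    show ?thesis
      unfolding eq ms.subspace_def by (simp add: lookup_add lookup_mscale mat_scale_def[symmetric])
  qed
  moreover have "?B \<subseteq> flip_fixed i \<inter> weight_space i 2"
    by (auto simp: symm_in_weight2[OF i])
  ultimately show "ms.span ?B \<subseteq> flip_fixed i \<inter> weight_space i 2"
    by (intro ms.span_minimal ms.subspace_inter subspace_flip_fixed)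
qed

lemma generated_by_weight2:
  assumes i: "i < 2" and card: "CARD('n) > 1"
  shows "generated_by mscale (flip_fixed i) (Yplus i)
    (flip_fixed i \<inter> weight_space i 2 :: ('f::field_char_0, 'n::finite) matpoly set)"
proof (rule generated_byI[OF i])
  fix W :: "('f, 'n) matpoly set"
  assume W: "ms.subspace W" "flip_fixed i \<inter> weight_space i 2 \<subseteq> W"
    "\<And>u w n. \<lbrakk>u \<in> W; w \<in> W\<rbrakk> \<Longrightarrow> mode (Yplus i) u n w \<in> W"
  have "symm i (elt e i 0) \<in> W" for e
    using W(2) symm_in_weight2[OF i] symm_in_flip_fixed by blast
  with W show "flip_fixed i \<subseteq> W"
    by (intro flip_fixed_subset_if_card_gt_1[OF i card]) auto
qed auto

text \<open>The first generator is fixed only up to a scalar \<open>r\<close>, since in copy 0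
  symmetrizing \<open>elt (mat 1) 0 0\<close> doubles it.\<close>

lemma generated_by_card_1:
  assumes i: "i < 2" and card: "CARD('n) = 1"
    and c: "c \<in> flip_fixed i" and g: "g \<noteq> 0" and S: "S = {v, c}" and v: "symm i (elt (mat 1) i 0)
      = mscale r v" "r \<noteq> 0"
    and mode_c: "\<And>n. \<exists>a b. mode (Yplus i) c 1 (elt (mat 1) n 0)
        = mscale (of_nat a * g) (elt (mat 1) (n + 2) 0) + mscale (of_nat (Suc b) * g) (elt (mat 1) n 2)"
  shows "generated_by mscale (flip_fixed i) (Yplus i) (S :: ('f::field_char_0, 'n::finite) matpoly set)"
proof (rule generated_byI[OF i])
  have "v = mscale (1 / r) (symm i (elt (mat 1) i 0))"
    using v by simp
  then have "v \<in> flip_fixed i"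
    using ms.subspace_scale[OF subspace_flip_fixed symm_in_flip_fixed] by metis
  then show "S \<subseteq> flip_fixed i" using c S by simp
next
  fix W :: "('f, 'n) matpoly set"
  assume W: "ms.subspace W" "S \<subseteq> W"
    "\<And>u w n. \<lbrakk>u \<in> W; w \<in> W\<rbrakk> \<Longrightarrow> mode (Yplus i) u n w \<in> W"
  show "flip_fixed i \<subseteq> W"
  proof (rule flip_fixed_subset_if_card_1[OF i card W(1) _ W(3) _ c g mode_c])
    show "symm i (elt (mat 1) i 0) \<in> W"
      unfolding v(1) using W S by (intro ms.subspace_scale) auto
    show "c \<in> W" using W S by auto
  qed
qed

lemma generated_R1_card_1:
  assumes "CARD('n) = 1"
  shows "generated_by mscale (flip_fixed 1) (Yplus 1)
    {elt (mat 1) 1 0 - elt (mat 1) 0 1, elt (mat 1) 3 0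
      - elt (mat 1) 0 3 :: ('f::field_char_0, 'n::finite) matpoly}"
proof -
  have one: "(1::nat) < 2" by simp
  show ?thesis
  proof (rule generated_by_card_1[OF _ assms _ _ refl, where g = 1 and r = 1])
    show "elt (mat 1) 3 0 - elt (mat 1) 0 3 \<in> (flip_fixed 1 :: ('f, 'n) matpoly set)"
      using symm_in_flip_fixed[of 1 "elt (mat 1 :: 'f^'n^'n) 3 0"]
        by (simp add: symm_elt flip_sign_def transpose_mat)
    show "symm 1 (elt (mat 1 :: 'f^'n^'n) 1 0) = mscale 1 (elt (mat 1) 1 0 - elt (mat 1) 0 1)"
      by (simp add: symm_elt flip_sign_def transpose_mat)
    fix n
    have *: "elt (mat 1) 3 0 - elt (mat 1) 0 3 = symm 1 (elt (mat 1 :: 'f^'n^'n) 3 0)"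
      by (simp add: symm_elt flip_sign_def transpose_mat)
    \<comment> \<open>The two binomials come from the first sums of the two monomials; the term at
      \<open>(n, 2)\<close> comes from the second sum of \<open>elt (mat 1) 3 0\<close>.\<close>
    have "mode (Yplus 1) (elt (mat 1) 3 0 - elt (mat 1) 0 3) 1 (elt (mat 1 :: 'f^'n^'n) n 0)
      = mscale (of_nat ((n + 2 choose 3) + (n + 3 choose 3)) * 1) (elt (mat 1) (n + 2) 0)
        + mscale (of_nat (Suc 0) * 1) (elt (mat 1) n 2)"
      unfolding * by (rule matpoly_eqI, simp only: mode_symm_elt[OF one] mode_elt[OF one] lookup_simps)
        (simp add: mode_coeff_def pole_shift_def flip_sign_def lookup_simps transpose_mat distrib_right
          del: binomial_Suc_Suc)
    then show "\<exists>a b. mode (Yplus 1) (elt (mat 1) 3 0 - elt (mat 1) 0 3) 1 (elt (mat 1 :: 'f^'n^'n) n 0)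
      = mscale (of_nat a * 1) (elt (mat 1) (n + 2) 0) + mscale (of_nat (Suc b) * 1) (elt (mat 1) n 2)"
      by blast
  qed simp_all
qed

lemma generated_R2_card_1:
  assumes "CARD('n) = 1"
  shows "generated_by mscale (flip_fixed 0) (Yplus 0)
    {elt (mat 1) 0 0, elt (mat 1) 1 1 :: ('f::field_char_0, 'n::finite) matpoly}"
proof -
  have zero: "(0::nat) < 2" by simp
  show ?thesis
  proof (rule generated_by_card_1[OF _ assms _ _ refl, where g = "- 1" and r = 2])
    show "elt (mat 1) 1 1 \<in> (flip_fixed 0 :: ('f, 'n) matpoly set)"
      by (simp add: flip_fixed_def flip_elt flip_sign_def transpose_mat)
    show "symm 0 (elt (mat 1 :: 'f^'n^'n) 0 0) = mscale 2 (elt (mat 1) 0 0)"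
      using ms.scale_left_distrib[of 1 1 "elt (mat 1 :: 'f^'n^'n) 0 0"]
      by (simp only: symm_def flip_elt flip_sign_def transpose_mat one_add_one ms.scale_one sm.scale_one
        if_True refl simp_thms)
    fix n
    \<comment> \<open>Both coefficients are negative because the second exponent 1 contributes one
      sign, hence \<open>g = - 1\<close>.\<close>
    have "mode (Yplus 0) (elt (mat 1) 1 1) 1 (elt (mat 1 :: 'f^'n^'n) n 0)
      = mscale (of_nat ((n + 1) * ((n + 2) * (n + 2))) * - 1) (elt (mat 1) (n + 2) 0)
        + mscale (of_nat (Suc 3) * - 1) (elt (mat 1) n 2)"
      by (rule matpoly_eqI, simp only: mode_elt[OF zero] lookup_simps)
        (simp add: mode_coeff_def pole_shift_def flip_sign_def lookup_simps transpose_mat algebra_simps)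
    then show "\<exists>a b. mode (Yplus 0) (elt (mat 1) 1 1) 1 (elt (mat 1 :: 'f^'n^'n) n 0)
      = mscale (of_nat a * - 1) (elt (mat 1) (n + 2) 0) + mscale (of_nat (Suc b) *
        - 1) (elt (mat 1) n 2)"
      by blast
  qed simp_all
qed

theorem theorem3p2:
  fixes R1 R2 :: "('f::field_char_0, 'n::finite) matpoly set"
  assumes R1: "R1 = module.span mscale
      {elt (matunit p q) m n - elt (matunit q p) n m |p q m n. True}"
    and R2: "R2 = module.span mscale
      {elt (matunit p q) m n + elt (matunit q p) n m |p q m n. True}"
  shows
    "(conformal_algebra mscale R1 partial (Yplus 1) \<and>
      conformal_simple mscale R1 partial (Yplus 1) \<and>
      conformal_algebra mscale R2 partial (Yplus 0) \<and>
      conformal_simple mscale R2 partial (Yplus 0))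
   \<and> (R1 \<inter> weight_space 1 2 = module.span mscale
        {elt (matunit p q) 1 0 - elt (matunit q p) 0 1 |p q. True} \<and>
      (CARD('n) > 1 \<longrightarrow> generated_by mscale R1 (Yplus 1) (R1 \<inter> weight_space 1 2)) \<and>
      (CARD('n) = 1 \<longrightarrow> generated_by mscale R1 (Yplus 1)
        {elt (mat 1) 1 0 - elt (mat 1) 0 1, elt (mat 1) 3 0 - elt (mat 1) 0 3}))
   \<and> (R2 \<inter> weight_space 0 2 = module.span mscale
        {elt (matunit p q) 0 0 + elt (matunit q p) 0 0 |p q. True} \<and>
      (CARD('n) > 1 \<longrightarrow> generated_by mscale R2 (Yplus 0) (R2 \<inter> weight_space 0 2)) \<and>
      (CARD('n) = 1 \<longrightarrow> generated_by mscale R2 (Yplus 0)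
        {elt (mat 1) 0 0, elt (mat 1) 1 1}))"
proof -
  have s1: "symm 1 (elt (matunit p q :: 'f^'n^'n) m n)
    = elt (matunit p q) m n - elt (matunit q p) n m" for p q m n
    by (simp add: symm_elt flip_sign_def)
  have s0: "symm 0 (elt (matunit p q :: 'f^'n^'n) m n)
    = elt (matunit p q) m n + elt (matunit q p) n m" for p q m n
    by (simp add: symm_elt flip_sign_def)
  have e1: "R1 = flip_fixed 1" unfolding R1 flip_fixed_eq_span s1 by (rule refl)
  have e0: "R2 = flip_fixed 0" unfolding R2 flip_fixed_eq_span s0 by (rule refl)
  have "(1::nat) < 2" "(0::nat) < 2" by simp_all
  note i = this
  show ?thesis
    unfolding e1 e0 s1[symmetric] s0[symmetric]
    by (intro conjI impI conformal_algebra_flip_fixed conformal_simple_flip_fixed weight2_eq_span[OF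
      i(1)] weight2_eq_span[OF i(2)]
        generated_by_weight2 i generated_R1_card_1 generated_R2_card_1)
qed

end
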